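(* Let $F$ be a (abstract) free group of countably infinite rank and let $w$ be a group word such that $F/w(F)$ is nilpotent. Then $w$ is strongly concise in the class of all profinite groups; that is, for every profinite group $G$ such that $\lvert G_w\rvert < 2^{\aleph_0}$, the verbal subgroup $w(G)$ is finite.
   Context: A group word $w=w(x_1,\ldots,x_r)$ is an element of the free group on $x_1,\ldots,x_r$. For a group $G$, $G_w=\{w(g_1,\ldots,g_r)\mid g_1,\ldots,g_r\in G\}$ is the set of $w$-values in $G$. For an abstract group such as $F$, $w(F)$ denotes the subgroup generated by $F_w$; for a profinite group $G$, $w(G)$ denotes the closed subgroup of $G$ generated by $G_w$. *)

theory Defs
  imports
    "HOL-Algebra.Generated_Groups"
    "HOL-Analysis.Analysis"
    "HOL-Library.Equipollence"
begin

section \<open>Free groups and group words\<close>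

text \<open>A letter \<open>(i, True)\<close> stands for the generator \<open>x\<^sub>i\<close> and \<open>(i, False)\<close> for its inverse.
  Elements of the free group are the freely reduced words.\<close>

type_synonym 'i gword = "('i \<times> bool) list"

definition inv_letter :: "'i \<times> bool \<Rightarrow> 'i \<times> bool"
  where "inv_letter a = (fst a, \<not> snd a)"

fun freely_reduced :: "'i gword \<Rightarrow> bool"
  where
    "freely_reduced (a # b # u) \<longleftrightarrow> b \<noteq> inv_letter a \<and> freely_reduced (b # u)"
  | "freely_reduced _ \<longleftrightarrow> True"

text \<open>Left multiplication of a freely reduced word by a letter, with cancellation.\<close>

fun push :: "'i \<times> bool \<Rightarrow> 'i gword \<Rightarrow> 'i gword"
  where
    "push a [] = [a]"
  | "push a (b # u) = (if b = inv_letter a then u else a # b # u)"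

definition free_group :: "'i set \<Rightarrow> 'i gword monoid"
  where "free_group X =
    \<lparr>carrier = {u. freely_reduced u \<and> fst ` set u \<subseteq> X}, monoid.mult = foldr push, one = []\<rparr>"

definition word_eval :: "('g, 'm) monoid_scheme \<Rightarrow> ('i \<Rightarrow> 'g) \<Rightarrow> 'i gword \<Rightarrow> 'g"
  where "word_eval G g w =
    foldr (\<lambda>(i, b) y. (if b then g i else inv\<^bsub>G\<^esub> (g i)) \<otimes>\<^bsub>G\<^esub> y) w \<one>\<^bsub>G\<^esub>"

text \<open>The following facts show that \<^term>\<open>free_group X\<close> is a group and that
  \<^const>\<open>word_eval\<close> is the homomorphism extending a given map on the generators.\<close>

lemma inv_letter_simps [simp]:
  "inv_letter (inv_letter a) = a" "inv_letter a \<noteq> a" "a \<noteq> inv_letter a"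
  "fst (inv_letter a) = fst a" "inv_letter a = inv_letter b \<longleftrightarrow> a = b"
  by (auto simp: inv_letter_def prod_eq_iff)

lemma reduced_ConsD: "freely_reduced (a # u) \<Longrightarrow> freely_reduced u"
  by (cases u) auto

lemma reduced_push: "freely_reduced u \<Longrightarrow> freely_reduced (push a u)"
  by (cases u) (auto dest: reduced_ConsD)

lemma reduced_foldr_push: "freely_reduced v \<Longrightarrow> freely_reduced (foldr push u v)"
  by (induction u) (auto intro: reduced_push)

lemma push_inv: "freely_reduced u \<Longrightarrow> push a (push (inv_letter a) u) = u"
  by (cases u rule: freely_reduced.cases) auto

lemma push_reduced: "freely_reduced (a # u) \<Longrightarrow> push a u = a # u"
  by (cases u) auto

lemma set_push: "set (push a u) \<subseteq> insert a (set u)"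
  by (cases u) auto

lemma set_foldr_push: "set (foldr push u v) \<subseteq> set u \<union> set v"
  by (induction u) (use set_push in fastforce)+

lemma foldr_push_Nil: "freely_reduced u \<Longrightarrow> foldr push u [] = u"
proof (induction u)
  case (Cons a u)
  then show ?case using reduced_ConsD[of a u] push_reduced[of a u] by simp
qed simp

lemma foldr_push_push:
  assumes "freely_reduced w"
  shows "foldr push (push a v) w = push a (foldr push v w)"
proof (cases v)
  case (Cons b v')
  have "push a (push (inv_letter a) (foldr push v' w)) = foldr push v' w"
    by (rule push_inv[OF reduced_foldr_push[OF assms]])
  then show ?thesis using Cons by auto
qed auto

lemma foldr_push_assoc:
  "freely_reduced w \<Longrightarrow> foldr push (foldr push u v) w = foldr push u (foldr push v w)"
  by (induction u) (auto simp: foldr_push_push)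

lemma foldr_push_snoc_inv:
  "freely_reduced v \<Longrightarrow> foldr push (map inv_letter (rev u)) (foldr push u v) = v"
proof (induction u arbitrary: v)
  case (Cons a u)
  have "push (inv_letter a) (push a (foldr push u v)) = foldr push u v"
    using push_inv[of "foldr push u v" "inv_letter a"] reduced_foldr_push Cons.prems by auto
  then show ?case using Cons by simp
qed auto

lemma reduced_snoc:
  "freely_reduced (u @ [a, b]) \<longleftrightarrow> freely_reduced (u @ [a]) \<and> b \<noteq> inv_letter a"
  by (induction u rule: freely_reduced.induct) auto

lemma reduced_inv: "freely_reduced u \<Longrightarrow> freely_reduced (map inv_letter (rev u))"
proof (induction u rule: freely_reduced.induct)
  case (1 a b u)
  then show ?case
    using reduced_snoc[of "map inv_letter (rev u)" "inv_letter b" "inv_letter a"]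
    by auto
qed auto

lemma group_free_group: "group (free_group X)"
proof (rule groupI)
  fix u assume u: "u \<in> carrier (free_group X)"
  let ?v = "map inv_letter (rev u)"
  have "foldr push ?v u = []"
    using foldr_push_snoc_inv[of "[]" u] foldr_push_Nil[of u] u by (simp add: free_group_def)
  moreover have "?v \<in> carrier (free_group X)"
    using u by (auto simp: free_group_def image_image intro: reduced_inv)
  ultimately show
    "\<exists>v \<in> carrier (free_group X). v \<otimes>\<^bsub>free_group X\<^esub> u = \<one>\<^bsub>free_group X\<^esub>"
    by (intro bexI[of _ ?v]) (simp_all add: free_group_def)
next
  fix u v assume "u \<in> carrier (free_group X)" "v \<in> carrier (free_group X)"
  then show "u \<otimes>\<^bsub>free_group X\<^esub> v \<in> carrier (free_group X)"
    using image_mono[OF set_foldr_push[of u v], of fst]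
    by (simp add: free_group_def reduced_foldr_push image_Un subset_trans)
qed (auto simp: free_group_def foldr_push_assoc)

context group
begin

lemma word_eval_closed:
  "\<lbrakk>\<And>x. x \<in> fst ` set u \<Longrightarrow> g x \<in> carrier G\<rbrakk> \<Longrightarrow> word_eval G g u \<in> carrier G"
  by (induction u) (auto simp: word_eval_def)

lemma word_eval_push:
  assumes "\<And>x. x \<in> fst ` set (a # u) \<Longrightarrow> g x \<in> carrier G"
  shows "word_eval G g (push a u) = word_eval G g (a # u)"
proof (cases u)
  case (Cons b u')
  have "word_eval G g u' \<in> carrier G" "g (fst a) \<in> carrier G"
    using assms Cons by (auto intro!: word_eval_closed)
  then show ?thesis
    using Cons by (cases a) (auto simp: word_eval_def inv_letter_def simp flip: m_assoc)
qed (simp add: word_eval_def)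

lemma word_eval_hom:
  assumes "g \<in> X \<rightarrow> carrier G"
  shows "word_eval G g \<in> hom (free_group X) G"
proof (rule homI)
  fix u v assume u: "u \<in> carrier (free_group X)" and v: "v \<in> carrier (free_group X)"
  show "word_eval G g u \<in> carrier G"
    using u assms by (intro word_eval_closed) (auto simp: free_group_def)
  have "word_eval G g (foldr push u v) = word_eval G g u \<otimes> word_eval G g v"
    if "fst ` set u \<subseteq> X" "fst ` set v \<subseteq> X" for u v
    using that
  proof (induction u)
    case Nil
    then have "word_eval G g v \<in> carrier G"
      using assms by (intro word_eval_closed) auto
    then show ?case by (simp add: word_eval_def)
  next
    case (Cons a u)
    have clo: "word_eval G g u \<in> carrier G" "word_eval G g v \<in> carrier G" "g (fst a) \<in> carrier G"
      using Cons.prems assms by (auto intro!: word_eval_closed)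
    have "word_eval G g (push a (foldr push u v)) = word_eval G g (a # foldr push u v)"
      using Cons.prems assms set_foldr_push[of u v] by (intro word_eval_push) fastforce
    moreover have "word_eval G g (foldr push u v) = word_eval G g u \<otimes> word_eval G g v"
      using Cons by auto
    ultimately show ?case
      using clo by (cases a) (auto simp: word_eval_def m_assoc)
  qed
  then show "word_eval G g (u \<otimes>\<^bsub>free_group X\<^esub> v) = word_eval G g u \<otimes> word_eval G g v"
    using u v by (simp add: free_group_def)
qed

lemma word_eval_generator: "g i \<in> carrier G \<Longrightarrow> word_eval G g [(i, True)] = g i"
  by (simp add: word_eval_def)

end

section \<open>Word values and verbal subgroups\<close>

definition word_values :: "('g, 'm) monoid_scheme \<Rightarrow> nat \<Rightarrow> nat gword \<Rightarrow> 'g set"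
  where "word_values G r w = {word_eval G g w | g. g \<in> {1..r} \<rightarrow> carrier G}"

definition verbal_subgroup :: "('g, 'm) monoid_scheme \<Rightarrow> nat \<Rightarrow> nat gword \<Rightarrow> 'g set"
  where "verbal_subgroup G r w = generate G (word_values G r w)"

definition closed_verbal_subgroup ::
    "('g, 'm) monoid_scheme \<Rightarrow> 'g topology \<Rightarrow> nat \<Rightarrow> nat gword \<Rightarrow> 'g set"
  where "closed_verbal_subgroup G T r w =
    (\<lambda>H. subgroup H G \<and> closedin T H) hull word_values G r w"

section \<open>Nilpotent groups\<close>

text \<open>The index is shifted by one: \<open>lower_central G n\<close> is \<open>\<gamma>\<^sub>n\<^sub>+\<^sub>1(G)\<close>.\<close>

primrec lower_central :: "('g, 'm) monoid_scheme \<Rightarrow> nat \<Rightarrow> 'g set"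
  where
    "lower_central G 0 = carrier G"
  | "lower_central G (Suc n) = generate G
      {x \<otimes>\<^bsub>G\<^esub> y \<otimes>\<^bsub>G\<^esub> inv\<^bsub>G\<^esub> x \<otimes>\<^bsub>G\<^esub> inv\<^bsub>G\<^esub> y | x y. x \<in> lower_central G n \<and> y \<in> carrier G}"

definition nilpotent_group :: "('g, 'm) monoid_scheme \<Rightarrow> bool"
  where "nilpotent_group G \<longleftrightarrow> group G \<and> (\<exists>n. lower_central G n = {\<one>\<^bsub>G\<^esub>})"

section \<open>Profinite groups\<close>

definition topological_group :: "('g, 'm) monoid_scheme \<Rightarrow> 'g topology \<Rightarrow> bool"
  where "topological_group G T \<longleftrightarrow>
    group G \<and> topspace T = carrier G \<and>
    continuous_map (prod_topology T T) T (\<lambda>(x, y). x \<otimes>\<^bsub>G\<^esub> y) \<and>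
    continuous_map T T (\<lambda>x. inv\<^bsub>G\<^esub> x)"

definition totally_disconnected :: "'g topology \<Rightarrow> bool"
  where "totally_disconnected T \<longleftrightarrow> (\<forall>S. connectedin T S \<longrightarrow> (\<exists>x. S \<subseteq> {x}))"

definition profinite_group :: "('g, 'm) monoid_scheme \<Rightarrow> 'g topology \<Rightarrow> bool"
  where "profinite_group G T \<longleftrightarrow>
    topological_group G T \<and> compact_space T \<and> Hausdorff_space T \<and> totally_disconnected T"

end

theory Submission
  imports Defs
begin

text \<open>A continuous map from a compact space to \<open>G\<close> with fewer than \<open>2\<^bsup>\<aleph>0\<^esup>\<close> values is constant on a
  nonempty open set. Since \<open>F/w(F)\<close> is nilpotent, the left-normed commutator \<open>\<gamma>\<close> of some length is a
  product of \<open>w\<close>-values and their inverses, so \<open>\<gamma>\<close> has few values in \<open>G\<close>. As \<open>\<gamma>\<close> is constant on a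
  product of nonempty open sets, \<open>G\<close> has an open normal nilpotent subgroup \<open>N\<close>. By the
  Lazard--Leibman theorem every word map is polynomial on products of cosets of \<open>N\<close>: iterated
  differences \<open>f(x)\<^sup>-\<^sup>1 f(xh)\<close> eventually vanish. By induction on the degree, a polynomial map with
  few values has finitely many values, because a difference has lower degree and finitely many
  translates of an open set on which \<open>f\<close> is constant cover the space. So \<open>\<gamma>\<close> and \<open>w\<close> have finitely
  many values in \<open>G\<close>.

  What remains is pure group theory. The values of \<open>\<gamma>\<close> generate a finite subgroup \<open>K\<close> by a variant of
  Dietzmann's lemma. Modulo \<open>K\<close> the group is nilpotent, so
  \<open>s \<mapsto> w(g\<^sub>1\<^sup>s,\<dots>,g\<^sub>r\<^sup>s)\<close> is a polynomial sequence with finitely many values; this forces its values to be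
  torsion, and Dietzmann's lemma applies to the set of \<open>w\<close>-values.\<close>

section \<open>Products over conjugation-invariant sets\<close>

text \<open>Few values give only local information: one nonempty open set on which the map is
  constant. Polynomial structure propagates it, because values on a translate of that set differ
  from the constant by a difference of lower degree. This structure needs nilpotency, which is
  available only for \<open>N\<close>; hence differences are taken along \<open>N\<close>, on boxes
  of cosets of \<open>N\<close>, finitely many of which cover the domain.

  The obstacle in the group-theoretic half is torsion: a finite conjugation-invariant set may
  generate an infinite group, as a central element of infinite order shows. For \<gamma> torsion is
  not known in advance, so it is replaced by the condition that some power \<open>s [^] e\<close> is
  a product of fewer than \<open>e\<close> members of the set; the free last entry of a commutator
  supplies such a shortening. A general \<open>w\<close> has no such identity, and torsion is
  instead read off from the sequence in the exponent \<open>s\<close>. The finite group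
  \<open>K\<close> need not be factored out for this: it contains a term of a filtration of
  \<open>G\<close>, and a finite term is all that \<open>torsion_diff\<close> asks for.\<close>

definition gcomm :: "('a, 'm) monoid_scheme \<Rightarrow> 'a \<Rightarrow> 'a \<Rightarrow> 'a"
  where "gcomm G x y = x \<otimes>\<^bsub>G\<^esub> y \<otimes>\<^bsub>G\<^esub> inv\<^bsub>G\<^esub> x \<otimes>\<^bsub>G\<^esub> inv\<^bsub>G\<^esub> y"

definition glist :: "('a, 'm) monoid_scheme \<Rightarrow> 'a list \<Rightarrow> 'a"
  where "glist G l = foldr (\<otimes>\<^bsub>G\<^esub>) l \<one>\<^bsub>G\<^esub>"

context group
begin

lemma cancel_inv: "\<lbrakk>x \<in> carrier G; y \<in> carrier G\<rbrakk> \<Longrightarrow> inv x \<otimes> (x \<otimes> y) = y"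
  "\<lbrakk>x \<in> carrier G; y \<in> carrier G\<rbrakk> \<Longrightarrow> x \<otimes> (inv x \<otimes> y) = y"
  by (simp_all flip: m_assoc)

text \<open>Brings both sides of a free-group identity to right-nested words with adjacent inverses
  cancelled; the commutator identities below are checked in this way.\<close>

lemmas word_simps = gcomm_def m_assoc inv_mult_group cancel_inv

lemma gcomm_closed [simp]: "\<lbrakk>x \<in> carrier G; y \<in> carrier G\<rbrakk> \<Longrightarrow> gcomm G x y \<in> carrier G"
  by (simp add: gcomm_def)

lemma gcomm_eq_one_iff:
  "\<lbrakk>x \<in> carrier G; y \<in> carrier G\<rbrakk> \<Longrightarrow> gcomm G x y = \<one> \<longleftrightarrow> x \<otimes> y = y \<otimes> x"
proof -
  assume "x \<in> carrier G" "y \<in> carrier G"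
  then have "gcomm G x y \<otimes> (y \<otimes> x) = x \<otimes> y" "gcomm G x y \<in> carrier G"
    by (simp_all add: word_simps)
  then show ?thesis
    using \<open>x \<in> carrier G\<close> \<open>y \<in> carrier G\<close> r_cancel_one'[of "y \<otimes> x" "gcomm G x y"] by auto
qed

lemma conj_pow:
  "\<lbrakk>x \<in> carrier G; y \<in> carrier G\<rbrakk> \<Longrightarrow> (y \<otimes> x \<otimes> inv y) [^] n = y \<otimes> x [^] n \<otimes> inv y" for n :: nat
  by (induction n) (simp_all add: word_simps)

lemma commute_pow:
  "\<lbrakk>x \<in> carrier G; y \<in> carrier G; x \<otimes> y = y \<otimes> x\<rbrakk> \<Longrightarrow> x [^] n \<otimes> y = y \<otimes> x [^] n" for n :: nat
proof (induction n)
  case (Suc n)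
  then have "x [^] n \<otimes> (x \<otimes> y) = (y \<otimes> x [^] n) \<otimes> x"
    by (simp flip: m_assoc)
  then show ?case using Suc.prems by (simp add: m_assoc)
qed simp

lemma glist_simps [simp]: "glist G [] = \<one>" "glist G (x # l) = x \<otimes> glist G l"
  by (simp_all add: glist_def)

lemma glist_closed [simp]: "set l \<subseteq> carrier G \<Longrightarrow> glist G l \<in> carrier G"
  by (induction l) auto

lemma glist_append:
  "\<lbrakk>set l \<subseteq> carrier G; set l' \<subseteq> carrier G\<rbrakk> \<Longrightarrow> glist G (l @ l') = glist G l \<otimes> glist G l'"
  by (induction l) (auto simp: m_assoc)

lemma glist_replicate: "x \<in> carrier G \<Longrightarrow> glist G (replicate n x) = x [^] n" for n :: nat
  by (induction n) (auto simp: nat_pow_Suc2[symmetric] simp del: nat_pow_Suc)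

definition conj_closed :: "'a set \<Rightarrow> bool"
  where "conj_closed S \<longleftrightarrow> S \<subseteq> carrier G \<and> (\<forall>g \<in> carrier G. \<forall>x \<in> S. g \<otimes> x \<otimes> inv g \<in> S)"

lemma conj_closedD:
  "\<lbrakk>conj_closed S; x \<in> S\<rbrakk> \<Longrightarrow> x \<in> carrier G"
  "\<lbrakk>conj_closed S; x \<in> S; g \<in> carrier G\<rbrakk> \<Longrightarrow> g \<otimes> x \<otimes> inv g \<in> S"
  by (auto simp: conj_closed_def)

text \<open>Moving a letter \<open>a\<close> behind the collected power \<open>p\<close> of
  \<open>s\<close> replaces it by \<open>inv p \<otimes> a \<otimes> p\<close>, which stays in
  \<open>S\<close> by closure under conjugation.\<close>

lemma glist_extract:
  assumes "conj_closed S" "s \<in> S" "set l \<subseteq> S"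
  shows "\<exists>l'. set l' \<subseteq> S \<and> length l' = length l - count_list l s \<and>
    glist G l = s [^] count_list l s \<otimes> glist G l'"
  using assms(3)
proof (induction l)
  case (Cons a l)
  have sub: "S \<subseteq> carrier G" using assms(1) by (auto simp: conj_closed_def)
  have s: "s \<in> carrier G" and a: "a \<in> carrier G" using Cons.prems assms(2) sub by auto
  obtain l' where l': "set l' \<subseteq> S" "length l' = length l - count_list l s"
    "glist G l = s [^] count_list l s \<otimes> glist G l'"
    using Cons by auto
  have gl: "glist G l' \<in> carrier G" using l'(1) sub by auto
  show ?case
  proof (cases "a = s")
    case True
    show ?thesis
      by (rule exI[of _ l'])
        (use True l' s gl nat_pow_Suc2[OF s, of "count_list l s"] in
          \<open>simp add: m_assoc del: nat_pow_Suc flip: m_assoc\<close>)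
  next
    case False
    define p where "p = s [^] count_list l s"
    have p: "p \<in> carrier G" by (simp add: p_def s)
    have "inv p \<otimes> a \<otimes> inv (inv p) \<in> S"
      using conj_closedD(2)[OF assms(1), of a "inv p"] Cons.prems p by simp
    moreover have "count_list l s \<le> length l" by (rule count_le_length)
    ultimately show ?thesis
      using False l' gl a p
      by (intro exI[of _ "(inv p \<otimes> a \<otimes> inv (inv p)) # l'"])
        (auto simp: word_simps Suc_diff_le simp flip: p_def)
  qed
qed auto

lemma glist_pow_closed:
  "s \<in> S \<Longrightarrow> S \<subseteq> carrier G \<Longrightarrow> \<exists>l. set l \<subseteq> S \<and> glist G l = s [^] n" for n :: nat
  by (rule exI[of _ "replicate n s"]) (auto simp: glist_replicate)

lemma torsion_of_pow_eq:
  fixes i j :: nat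
  assumes "x \<in> carrier G" "x [^] i = x [^] j" "i < j"
  shows "x [^] (j - i) = \<one>"
  using assms pow_eq_div2 by metis

lemma finite_range_torsion:
  assumes "x \<in> carrier G" "finite M" "\<And>n::nat. x [^] n \<in> M"
  obtains k :: nat where "k > 0" "x [^] k = \<one>"
proof -
  have "finite (range (\<lambda>n::nat. x [^] n))"
    using assms(2,3) by (meson finite_subset image_subsetI)
  then have "\<not> inj (\<lambda>n::nat. x [^] n)"
    using finite_imageD infinite_UNIV_nat by blast
  then obtain i j :: nat where "i \<noteq> j" "x [^] i = x [^] j"
    by (auto simp: inj_def)
  then obtain i j :: nat where "i < j" "x [^] i = x [^] j"
    by (metis nat_neq_iff)
  then show thesis
    using that[of "j - i"] torsion_of_pow_eq[OF assms(1)] by auto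
qed

text \<open>Dietzmann's lemma with a relaxed torsion condition: the occurrences of \<open>s\<close> in a product
  can be collected at its front, so a product of minimal length contains \<open>s\<close> fewer than \<open>e\<close> times.\<close>

lemma finite_generate_conj_closed:
  assumes "finite S" "conj_closed S"
    and "\<And>s. s \<in> S \<Longrightarrow> \<exists>e l. set l \<subseteq> S \<and> length l < e \<and> s [^] e = glist G l"
  shows "finite (generate G S)"
proof -
  have sub: "S \<subseteq> carrier G" using assms(2) by (auto simp: conj_closed_def)
  obtain e :: "'a \<Rightarrow> nat" where e:
    "\<And>s. s \<in> S \<Longrightarrow> \<exists>l. set l \<subseteq> S \<and> length l < e s \<and> s [^] e s = glist G l"
    using assms(3) by metis
  \<comment> \<open>Pigeonhole bound: a list over \<open>S\<close> longer than \<open>B\<close>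
    contains some \<open>s\<close> at least \<open>e s\<close> times.\<close>
  define B where "B = (\<Sum>s\<in>S. e s)"
  define M where "M = {glist G l | l. set l \<subseteq> S}"
  have short: "\<exists>l'. set l' \<subseteq> S \<and> length l' \<le> B \<and> glist G l' = glist G l" if "set l \<subseteq> S" for l
    using that
  proof (induction "length l" arbitrary: l rule: less_induct)
    case less
    show ?case
    proof (cases "length l \<le> B")
      case False
      have "\<exists>s \<in> S. e s \<le> count_list l s"
      proof (rule ccontr)
        assume "\<not> ?thesis"
        then have "(\<Sum>s\<in>S. count_list l s) \<le> B"
          unfolding B_def by (intro sum_mono) (meson not_le less_imp_le)
        then show False
          using False less.prems sum_count_set[OF less.prems assms(1)] by simp
      qed
      then obtain s where s: "s \<in> S" "e s \<le> count_list l s" by blast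
      obtain l1 where l1: "set l1 \<subseteq> S" "length l1 = length l - count_list l s"
        "glist G l = s [^] count_list l s \<otimes> glist G l1"
        using glist_extract[OF assms(2) s(1) less.prems] by blast
      obtain l2 where l2: "set l2 \<subseteq> S" "length l2 < e s" "s [^] e s = glist G l2"
        using e[OF s(1)] by blast
      \<comment> \<open>The block \<open>s [^] e s\<close> is traded for the shorter
        \<open>l2\<close>. The induction is on the length alone, so the letters of \<open>l2\<close>
        are irrelevant.\<close>
      define l3 where "l3 = l2 @ replicate (count_list l s - e s) s @ l1"
      have sc: "s \<in> carrier G" using s sub by auto
      have l3: "set l3 \<subseteq> S" using l1 l2 s by (auto simp: l3_def)
      have "glist G l3 = (s [^] e s \<otimes> s [^] (count_list l s - e s)) \<otimes> glist G l1"
        using subset_trans[OF l1(1) sub] subset_trans[OF l2(1) sub] l2(3) sc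
        by (simp add: l3_def glist_append glist_replicate m_assoc set_replicate_conv_if)
      also have "\<dots> = glist G l"
        using s sc l1 by (simp add: nat_pow_mult)
      finally have eq: "glist G l3 = glist G l" .
      have "count_list l s \<le> length l" by (rule count_le_length)
      then have "length l3 < length l"
        using l1 l2 s by (simp add: l3_def)
      then show ?thesis using less.hyps[of l3] l3 eq by metis
    qed (use less.prems in auto)
  qed
  have "M \<subseteq> glist G ` {l. set l \<subseteq> S \<and> length l \<le> B}"
  proof
    fix x assume "x \<in> M"
    then obtain l where "set l \<subseteq> S" "x = glist G l" by (auto simp: M_def)
    then show "x \<in> glist G ` {l. set l \<subseteq> S \<and> length l \<le> B}"
      using short[of l] by (metis (mono_tags, lifting) image_eqI mem_Collect_eq)
  qed
  then have fin: "finite M"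
    using finite_surj finite_lists_length_le[OF assms(1)] by blast
  have powM: "s [^] n \<in> M" if "s \<in> S" for s and n :: nat
    using glist_pow_closed[OF that sub, of n] unfolding M_def by (metis (mono_tags, lifting) mem_Collect_eq)
  have "generate G S \<subseteq> M"
  proof
    fix x assume "x \<in> generate G S"
    then show "x \<in> M"
    proof induction
      case one
      show ?case by (auto simp: M_def intro!: exI[of _ "[]"])
    next
      case (incl s)
      then show ?case using powM[of s 1] sub by auto
    next
      case (inv s)
      then have sc: "s \<in> carrier G" using sub by auto
      \<comment> \<open>Torsion comes out as a consequence: the powers of \<open>s\<close> stay in
        the finite set \<open>M\<close>. It turns the inverse into a nonnegative power, hence a
        member of \<open>M\<close>.\<close>
      obtain k :: nat where k: "k > 0" "s [^] k = \<one>"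
        using finite_range_torsion[OF sc fin] powM[OF inv] by blast
      then have "s \<otimes> s [^] (k - 1) = \<one>"
        using sc by (metis One_nat_def Suc_pred nat_pow_Suc2)
      then have "inv s = s [^] (k - 1)"
        using sc by (simp add: inv_equality inv_comm)
      then show ?case using powM[OF inv] by simp
    next
      case (eng x y)
      then obtain l l' where "set l \<subseteq> S" "x = glist G l" "set l' \<subseteq> S" "y = glist G l'"
        by (auto simp: M_def)
      then show ?case
        using glist_append[of l l'] sub
        by (auto simp: M_def intro!: exI[of _ "l @ l'"])
    qed
  qed
  then show ?thesis using fin finite_subset by blast
qed

lemma finite_generate_torsion:
  assumes "finite S" "conj_closed S" "\<And>s. s \<in> S \<Longrightarrow> \<exists>e>0. s [^] (e::nat) = \<one>"
  shows "finite (generate G S)"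
proof (rule finite_generate_conj_closed[OF assms(1,2)])
  fix s assume "s \<in> S"
  then obtain e :: nat where "e > 0" "s [^] e = \<one>" using assms(3) by blast
  then show "\<exists>e l. set l \<subseteq> S \<and> length l < e \<and> s [^] e = glist G l"
    by (intro exI[of _ e] exI[of _ "[]"]) simp
qed

text \<open>Conjugation by \<open>g\<close> acts on the finite set \<open>S\<close>, so two powers
  of \<open>g\<close> act alike and the power with the difference of exponents acts
  trivially.\<close>

lemma exists_pow_centralizing:
  assumes "finite S" "conj_closed S" "g \<in> carrier G"
  obtains k :: nat where "k > 0" "\<And>s. s \<in> S \<Longrightarrow> g [^] k \<otimes> s = s \<otimes> g [^] k"
proof -
  define f where "f n = (\<lambda>s \<in> S. g [^] n \<otimes> s \<otimes> inv (g [^] n))" for n :: nat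
  have "range f \<subseteq> S \<rightarrow>\<^sub>E S"
    using assms by (auto simp: f_def conj_closed_def)
  then have "finite (range f)"
    using assms(1) by (meson finite_PiE finite_subset)
  then have "\<not> inj f"
    using finite_imageD infinite_UNIV_nat by blast
  then obtain i j where "i \<noteq> j" "f i = f j"
    by (auto simp: inj_def)
  then obtain i j where ij: "i < j" "f i = f j"
    by (metis nat_neq_iff)
  have "g [^] (j - i) \<otimes> s = s \<otimes> g [^] (j - i)" if s: "s \<in> S" for s
  proof -
    have sc: "s \<in> carrier G" using s assms(2) by (auto simp: conj_closed_def)
    define a b where "a = g [^] i" and "b = g [^] (j - i)"
    have c: "a \<in> carrier G" "b \<in> carrier G" using assms(3) by (auto simp: a_def b_def)
    have ab: "g [^] j = a \<otimes> b"
      using ij assms(3) by (simp add: a_def b_def nat_pow_mult)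
    have "a \<otimes> s \<otimes> inv a = a \<otimes> b \<otimes> s \<otimes> inv (a \<otimes> b)"
      using fun_cong[OF ij(2), of s] s by (simp add: f_def ab flip: a_def)
    then have "a \<otimes> (s \<otimes> inv a) = a \<otimes> ((b \<otimes> s \<otimes> inv b) \<otimes> inv a)"
      using c sc by (simp add: word_simps)
    then have "s = b \<otimes> s \<otimes> inv b"
      using c sc by simp
    then have "s \<otimes> b = b \<otimes> s"
      using c sc by (metis inv_solve_right m_closed)
    then show ?thesis by (simp add: b_def)
  qed
  then show thesis using that[of "j - i"] ij by auto
qed

end

section \<open>Left-normed commutators\<close>

text \<open>Index \<open>n\<close> means \<open>n + 1\<close> entries, in step with
  \<open>lower_central\<close>. Recursion on sets of values is possible because every new entry is
  independent of the earlier ones.\<close>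

primrec gamma_values :: "('a, 'm) monoid_scheme \<Rightarrow> nat \<Rightarrow> 'a set"
  where
    "gamma_values G 0 = carrier G"
  | "gamma_values G (Suc n) = {gcomm G u y | u y. u \<in> gamma_values G n \<and> y \<in> carrier G}"

context group
begin

lemma gcomm_conj:
  "\<lbrakk>x \<in> carrier G; y \<in> carrier G; g \<in> carrier G\<rbrakk> \<Longrightarrow>
    g \<otimes> gcomm G x y \<otimes> inv g = gcomm G (g \<otimes> x \<otimes> inv g) (g \<otimes> y \<otimes> inv g)"
  by (simp add: word_simps)

lemma gcomm_mult_left:
  "\<lbrakk>x \<in> carrier G; y \<in> carrier G; z \<in> carrier G\<rbrakk> \<Longrightarrow>
    gcomm G (x \<otimes> y) z = (x \<otimes> gcomm G y z \<otimes> inv x) \<otimes> gcomm G x z"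
  by (simp add: word_simps)

lemma gamma_values_closed: "gamma_values G n \<subseteq> carrier G"
  by (induction n) auto

lemma conj_closed_gamma_values: "conj_closed (gamma_values G n)"
proof (induction n)
  case (Suc n)
  show ?case
    unfolding conj_closed_def
  proof (intro conjI ballI)
    fix g x assume g: "g \<in> carrier G" and "x \<in> gamma_values G (Suc n)"
    then obtain u y where uy: "x = gcomm G u y" "u \<in> gamma_values G n" "y \<in> carrier G" by auto
    then have "g \<otimes> x \<otimes> inv g = gcomm G (g \<otimes> u \<otimes> inv g) (g \<otimes> y \<otimes> inv g)"
      using gcomm_conj g gamma_values_closed by blast
    then show "g \<otimes> x \<otimes> inv g \<in> gamma_values G (Suc n)"
      using uy g conj_closedD(2)[OF Suc, of u g] by auto
  qed (use gamma_values_closed in blast)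
qed (auto simp: conj_closed_def)

lemma subgroup_nat_pow_closed:
  "\<lbrakk>subgroup H G; x \<in> H\<rbrakk> \<Longrightarrow> x [^] n \<in> H" for n :: nat
  by (induction n) (simp_all add: subgroup.one_closed subgroup.m_closed)

lemma commute_inv:
  assumes "s \<in> carrier G" "c \<in> carrier G" "c \<otimes> s = s \<otimes> c"
  shows "c \<otimes> inv s = inv s \<otimes> c"
proof -
  have "inv s \<otimes> (c \<otimes> s) \<otimes> inv s = inv s \<otimes> c"
    using assms(1,2) by (simp add: m_assoc)
  moreover have "inv s \<otimes> (s \<otimes> c) \<otimes> inv s = c \<otimes> inv s"
    using assms(1,2) by (simp add: m_assoc cancel_inv)
  ultimately show ?thesis using assms(3) by simp
qed

lemma commute_generate:
  assumes "S \<subseteq> carrier G" "c \<in> carrier G" "\<And>s. s \<in> S \<Longrightarrow> c \<otimes> s = s \<otimes> c"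
    and "x \<in> generate G S"
  shows "c \<otimes> x = x \<otimes> c"
  using assms(4)
proof induction
  case (inv s)
  then show ?case using assms by (intro commute_inv) auto
next
  case (eng x y)
  have "x \<in> carrier G" "y \<in> carrier G"
    using eng generate_in_carrier[OF assms(1)] by auto
  then have "c \<otimes> (x \<otimes> y) = (x \<otimes> c) \<otimes> y"
    using eng assms(2) by (simp flip: m_assoc)
  also have "\<dots> = x \<otimes> y \<otimes> c"
    using \<open>x \<in> carrier G\<close> \<open>y \<in> carrier G\<close> eng assms(2) by (simp add: m_assoc)
  finally show ?case .
qed (use assms in auto)

section \<open>The endomorphism \<open>[a, y]\<close> of an abelian subgroup\<close>

context
  fixes A y
  assumes A: "subgroup A G" "\<And>a b. a \<in> A \<Longrightarrow> b \<in> A \<Longrightarrow> a \<otimes> b = b \<otimes> a"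
    and y: "y \<in> carrier G" "\<And>a. a \<in> A \<Longrightarrow> gcomm G a y \<in> A"
begin

text \<open>The conjugation by \<open>a\<close> in \<open>gcomm_mult_left\<close> is trivial on the
  abelian group \<open>A\<close>.\<close>

lemma gcomm_abelian_mult:
  assumes "a \<in> A" "b \<in> A"
  shows "gcomm G (a \<otimes> b) y = gcomm G a y \<otimes> gcomm G b y"
proof -
  have c: "a \<in> carrier G" "b \<in> carrier G" using assms subgroup.mem_carrier[OF A(1)] by auto
  have "a \<otimes> gcomm G b y \<otimes> inv a = gcomm G b y"
    using A(2)[OF assms(1) y(2)[OF assms(2)]] c y(1) by (simp add: m_assoc)
  then show ?thesis
    using gcomm_mult_left[OF c y(1)] A(2) y(2) assms by simp
qed

lemma gcomm_abelian_pow: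
  fixes n :: nat
  assumes "a \<in> A"
  shows "gcomm G (a [^] n) y = gcomm G a y [^] n"
proof (induction n)
  case 0
  then show ?case using y(1) by (simp add: gcomm_def)
next
  case (Suc n)
  have "a [^] n \<in> A" using A(1) assms by (simp add: subgroup_nat_pow_closed)
  then show ?case using Suc gcomm_abelian_mult assms by simp
qed

lemma gcomm_funpow_abelian:
  assumes "a \<in> A"
  shows "((\<lambda>a. gcomm G a y) ^^ k) a \<in> A"
    "((\<lambda>a. gcomm G a y) ^^ k) (a [^] (n::nat)) = ((\<lambda>a. gcomm G a y) ^^ k) a [^] n"
proof (induction k)
  case (Suc k)
  {
    case 1
    show ?case using Suc y by simp
  next
    case 2
    show ?case using Suc gcomm_abelian_pow by simp
  }
qed (use assms in auto)

text \<open>By induction some power \<open>b\<close> of \<open>a\<close> has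
  \<open>z = [b, y]\<close> commuting with \<open>y\<close>. Then
  \<open>[b, y [^] i] = z [^] i\<close> for all \<open>i\<close>. At \<open>i = m\<close> the left
  side is trivial, so \<open>z [^] m = \<one>\<close>, which is
  \<open>[b [^] m, y] = \<one>\<close>.\<close>

lemma exists_pow_commuting:
  fixes m :: nat
  assumes "m > 0" "\<And>a. a \<in> A \<Longrightarrow> y [^] m \<otimes> a = a \<otimes> y [^] m"
    and "a \<in> A" "((\<lambda>a. gcomm G a y) ^^ k) a = \<one>"
  shows "\<exists>M::nat>0. a [^] M \<otimes> y = y \<otimes> a [^] M"
  using assms(3,4)
proof (induction k arbitrary: a)
  case 0
  then show ?case using y(1) by (intro exI[of _ 1]) auto
next
  case (Suc k)
  have AG: "\<And>a. a \<in> A \<Longrightarrow> a \<in> carrier G" by (rule subgroup.mem_carrier[OF A(1)])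
  have "((\<lambda>a. gcomm G a y) ^^ k) (gcomm G a y) = \<one>"
    using Suc.prems(2) by (simp only: funpow_Suc_right o_apply)
  then obtain M :: nat where M: "M > 0" "gcomm G a y [^] M \<otimes> y = y \<otimes> gcomm G a y [^] M"
    using Suc.IH y(2)[OF Suc.prems(1)] by blast
  define b z where "b = a [^] M" and "z = gcomm G b y"
  have bA: "b \<in> A" using A(1) Suc.prems by (simp add: b_def subgroup_nat_pow_closed)
  then have zA: "z \<in> A" by (simp add: z_def y)
  note c = AG[OF bA] AG[OF zA] y(1)
  have zy: "z \<otimes> y = y \<otimes> z"
    using M gcomm_abelian_pow[OF Suc.prems(1)] by (simp add: z_def b_def)
  have by_eq: "b \<otimes> y = z \<otimes> (y \<otimes> b)"
    using c(1,3) by (simp add: z_def word_simps)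
  have step: "b \<otimes> y [^] i = z [^] i \<otimes> (y [^] i \<otimes> b)" for i :: nat
  proof (induction i)
    case 0
    show ?case using c by simp
  next
    case (Suc i)
    have "b \<otimes> y [^] Suc i = (b \<otimes> y [^] i) \<otimes> y" using c by (simp add: m_assoc)
    also have "\<dots> = z [^] i \<otimes> (y [^] i \<otimes> (b \<otimes> y))" using c Suc by (simp add: m_assoc)
    also have "\<dots> = z [^] i \<otimes> ((y [^] i \<otimes> z) \<otimes> (y \<otimes> b))" using c by (simp add: by_eq m_assoc)
    also have "\<dots> = z [^] Suc i \<otimes> (y [^] Suc i \<otimes> b)"
      using c commute_pow[OF c(3) c(2) zy[symmetric], of i] by (simp add: m_assoc)
    finally show ?case .
  qed
  have "z [^] m \<otimes> (b \<otimes> y [^] m) = b \<otimes> y [^] m"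
    using step[of m] assms(2)[OF bA] by simp
  then have "z [^] m = \<one>"
    using c by simp
  then have "gcomm G (b [^] m) y = \<one>"
    using gcomm_abelian_pow[OF bA] by (simp add: z_def)
  then have "b [^] m \<otimes> y = y \<otimes> b [^] m"
    using gcomm_eq_one_iff c by simp
  then show ?case
    using assms(1) M(1) AG[OF Suc.prems(1)] by (intro exI[of _ "M * m"]) (simp add: b_def nat_pow_pow)
qed

end

lemma gamma_values_funpow:
  "\<lbrakk>a \<in> carrier G; y \<in> carrier G\<rbrakk> \<Longrightarrow> ((\<lambda>a. gcomm G a y) ^^ n) a \<in> gamma_values G n"
  by (induction n) auto

text \<open>The set of values of a \<open>\<gamma>\<close>-word being finite, a power of \<open>v = [u,y]\<close> commutes with \<open>y\<close>;
  then \<open>v\<^bsup>e+1\<^esup> = [u,y\<^sup>2] (v\<^sup>y)\<^bsup>e-1\<^esup>\<close> shortens products of values.\<close>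

theorem finite_generate_gamma_values:
  assumes fin: "finite (gamma_values G (Suc n))"
  shows "finite (generate G (gamma_values G (Suc n)))"
proof (rule finite_generate_conj_closed[OF fin conj_closed_gamma_values])
  define S where "S = gamma_values G (Suc n)"
  have S: "finite S" "conj_closed S" "S \<subseteq> carrier G"
    using fin conj_closed_gamma_values gamma_values_closed by (auto simp: S_def simp del: gamma_values.simps)
  fix v assume "v \<in> gamma_values G (Suc n)"
  then obtain u y where v: "v = gcomm G u y" and u: "u \<in> gamma_values G n" and y: "y \<in> carrier G"
    and vS: "v \<in> S"
    by (auto simp: S_def)
  have uc: "u \<in> carrier G" using u gamma_values_closed by blast
  have vc: "v \<in> carrier G" using vS S by auto
  \<comment> \<open>\<open>A\<close> is the centre of the subgroup generated by \<open>S\<close>; it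
    is abelian, and closed under conjugation in \<open>G\<close> because \<open>S\<close>
    is.\<close>
  define A where "A = {a \<in> generate G S. \<forall>s \<in> S. a \<otimes> s = s \<otimes> a}"
  have genS: "subgroup (generate G S) G" by (rule generate_is_subgroup[OF S(3)])
  have Ac: "a \<in> carrier G" if "a \<in> A" for a
    using that generate_in_carrier[OF S(3)] by (auto simp: A_def)
  have A_gen: "a \<otimes> x = x \<otimes> a" if "a \<in> A" "x \<in> generate G S" for a x
    using commute_generate[OF S(3) Ac[OF that(1)] _ that(2)] that(1) by (auto simp: A_def)
  have A_sub: "subgroup A G"
  proof (rule subgroupI)
    show "A \<noteq> {}"
      using S(3) by (auto simp: A_def intro!: exI[of _ \<one>] generate.one)
    fix a assume a: "a \<in> A"
    have "inv a \<otimes> s = s \<otimes> inv a" if "s \<in> S" for s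
      using commute_inv[OF Ac[OF a], of s] a that S(3) by (auto simp: A_def)
    then show "inv a \<in> A" using a S(3) by (auto simp: A_def generate_m_inv_closed)
    fix b assume b: "b \<in> A"
    have "(a \<otimes> b) \<otimes> s = s \<otimes> (a \<otimes> b)" if "s \<in> S" for s
    proof -
      have sc: "s \<in> carrier G" using that S(3) by auto
      have "(a \<otimes> b) \<otimes> s = a \<otimes> (s \<otimes> b)"
        using b that Ac[OF a] Ac[OF b] sc by (simp add: A_def m_assoc)
      also have "\<dots> = (s \<otimes> a) \<otimes> b"
        using a that Ac[OF a] Ac[OF b] sc by (simp add: A_def flip: m_assoc)
      finally show ?thesis using Ac[OF a] Ac[OF b] sc by (simp add: m_assoc)
    qed
    then show "a \<otimes> b \<in> A" using a b by (auto simp: A_def intro: generate.eng)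
  qed (use Ac in auto)
  have A_comm: "a \<otimes> b = b \<otimes> a" if "a \<in> A" "b \<in> A" for a b
    using A_gen that by (auto simp: A_def)
  have gen_conj: "g \<otimes> x \<otimes> inv g \<in> generate G S" if "g \<in> carrier G" "x \<in> generate G S" for g x
  proof -
    have "generate G S \<lhd> G"
      by (rule normal_generateI[OF S(3)]) (rule conj_closedD(2)[OF S(2)])
    then show ?thesis by (rule normal.inv_op_closed2[OF _ that])
  qed
  have A_conj: "g \<otimes> a \<otimes> inv g \<in> A" if "g \<in> carrier G" "a \<in> A" for g a
  proof -
    have ac: "a \<in> carrier G" by (rule Ac[OF that(2)])
    have "(g \<otimes> a \<otimes> inv g) \<otimes> s = s \<otimes> (g \<otimes> a \<otimes> inv g)" if s: "s \<in> S" for s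
    proof -
      have sc: "s \<in> carrier G" using s S(3) by auto
      define t where "t = inv g \<otimes> s \<otimes> g"
      have t: "t \<in> S" using conj_closedD(2)[OF S(2) s, of "inv g"] \<open>g \<in> carrier G\<close> by (simp add: t_def)
      have "(g \<otimes> a \<otimes> inv g) \<otimes> s = g \<otimes> (a \<otimes> t) \<otimes> inv g"
        using ac sc \<open>g \<in> carrier G\<close> by (simp add: t_def word_simps)
      also have "\<dots> = g \<otimes> (t \<otimes> a) \<otimes> inv g"
        using \<open>a \<in> A\<close> t by (simp add: A_def)
      also have "\<dots> = s \<otimes> (g \<otimes> a \<otimes> inv g)"
        using ac sc \<open>g \<in> carrier G\<close> by (simp add: t_def word_simps)
      finally show ?thesis .
    qed
    then show ?thesis using that gen_conj by (auto simp: A_def)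
  qed
  have A_gcomm: "gcomm G a y \<in> A" if "a \<in> A" for a
  proof -
    have "gcomm G a y = a \<otimes> (y \<otimes> inv a \<otimes> inv y)"
      using Ac[OF that] y by (simp add: word_simps)
    then show ?thesis
      using that A_sub A_conj[OF y] by (simp add: subgroup.m_closed subgroup.m_inv_closed)
  qed
  obtain m1 :: nat where m1: "m1 > 0" "\<And>s. s \<in> S \<Longrightarrow> v [^] m1 \<otimes> s = s \<otimes> v [^] m1"
    using exists_pow_centralizing[OF S(1,2) vc] by blast
  obtain m2 :: nat where m2: "m2 > 0" "\<And>s. s \<in> S \<Longrightarrow> y [^] m2 \<otimes> s = s \<otimes> y [^] m2"
    using exists_pow_centralizing[OF S(1,2) y] by blast
  have "v \<in> generate G S" using vS by (rule generate.incl)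
  then have q: "v [^] m1 \<in> A"
    using m1 subgroup_nat_pow_closed[OF genS] by (auto simp: A_def)
  define q where "q = ((\<lambda>a. gcomm G a y) ^^ Suc n) (v [^] m1)"
  note abelian = A_sub A_comm y A_gcomm
  \<comment> \<open>On \<open>A\<close> the iterated commutator commutes with powers, so
    \<open>q [^] j\<close> is the commutator with first entry \<open>(v [^] m1) [^] j\<close> and
    all others \<open>y\<close>. It is again a \<gamma>-value, and finiteness makes \<open>q\<close>
    torsion.\<close>
  have "q [^] j \<in> S" for j :: nat
    using gcomm_funpow_abelian(2)[OF abelian q, of "Suc n" j]
      gamma_values_funpow[OF _ y, of "(v [^] m1) [^] j" "Suc n"] vc
    unfolding q_def S_def by (metis nat_pow_closed)
  then obtain e :: nat where e: "e > 0" "q [^] e = \<one>"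
    using finite_range_torsion[OF _ S(1), of q] S(3) Ac gcomm_funpow_abelian(1)[OF abelian q]
    unfolding q_def by blast
  have "((\<lambda>a. gcomm G a y) ^^ Suc n) ((v [^] m1) [^] e) = \<one>"
    using gcomm_funpow_abelian(2)[OF abelian q, of "Suc n" e] e(2) by (simp only: q_def)
  moreover have "(v [^] m1) [^] e \<in> A"
    using q A_sub subgroup_nat_pow_closed by blast
  moreover have "y [^] m2 \<otimes> a = a \<otimes> y [^] m2" if "a \<in> A" for a
    using commute_generate[OF S(3) _ m2(2), of a] that y by (auto simp: A_def)
  ultimately obtain M :: nat where M: "M > 0"
    "((v [^] m1) [^] e) [^] M \<otimes> y = y \<otimes> ((v [^] m1) [^] e) [^] M"
    using exists_pow_commuting[OF abelian m2(1), of "(v [^] m1) [^] e"] by blast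
  \<comment> \<open>Since \<open>v [^] N\<close> commutes with \<open>y\<close>, the conjugate
    \<open>v'\<close> has the same \<open>N\<close>-th power, so all but one factor of
    \<open>v [^] Suc N\<close> may be replaced by \<open>v'\<close>.\<close>
  define N where "N = m1 * e * M"
  have N: "N > 0" "v [^] N \<otimes> y = y \<otimes> v [^] N"
    using M m1(1) e(1) vc by (auto simp: N_def nat_pow_pow)
  define v' where "v' = y \<otimes> v \<otimes> inv y"
  have v': "v' \<in> S" "v' \<in> carrier G"
    using conj_closedD(2)[OF S(2) vS y] vc y by (auto simp: v'_def)
  have "v [^] Suc N = v \<otimes> v [^] N" by (rule nat_pow_Suc2[OF vc])
  also have "v [^] N = v' [^] N"
  proof -
    have "v' [^] N = (y \<otimes> v [^] N) \<otimes> inv y"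
      by (simp add: v'_def conj_pow[OF vc y])
    also have "\<dots> = v [^] N"
      using vc y by (simp add: N(2)[symmetric] m_assoc)
    finally show ?thesis by simp
  qed
  also have "v' [^] N = v' \<otimes> v' [^] (N - 1)"
    using N(1) v'(2) nat_pow_Suc2[of v' "N - 1"] by simp
  also have "v \<otimes> (v' \<otimes> v' [^] (N - 1)) = gcomm G u (y \<otimes> y) \<otimes> v' [^] (N - 1)"
  proof -
    have "gcomm G u (y \<otimes> y) = v \<otimes> v'"
      using uc y by (simp add: v v'_def word_simps)
    then show ?thesis using vc v' by (simp add: m_assoc)
  qed
  also have "\<dots> = glist G (gcomm G u (y \<otimes> y) # replicate (N - 1) v')"
    using v' by (simp add: glist_replicate)
  finally have "v [^] Suc N = glist G (gcomm G u (y \<otimes> y) # replicate (N - 1) v')" .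
  moreover have "gcomm G u (y \<otimes> y) \<in> S"
    using u y by (auto simp: S_def)
  then have "set (gcomm G u (y \<otimes> y) # replicate (N - 1) v') \<subseteq> S"
    using v'(1) by (auto simp: set_replicate_conv_if)
  moreover have "length (gcomm G u (y \<otimes> y) # replicate (N - 1) v') < Suc N"
    using N(1) by simp
  ultimately show "\<exists>e l. set l \<subseteq> gamma_values G (Suc n) \<and> length l < e \<and> v [^] e = glist G l"
    unfolding S_def by blast
qed

section \<open>Commutators modulo normal subgroups and relative central series\<close>

lemma gcomm_inv_left:
  "\<lbrakk>x \<in> carrier G; y \<in> carrier G\<rbrakk> \<Longrightarrow> gcomm G (inv x) y = inv x \<otimes> inv (gcomm G x y) \<otimes> x"
  by (simp add: word_simps)

lemma inv_gcomm: "\<lbrakk>x \<in> carrier G; y \<in> carrier G\<rbrakk> \<Longrightarrow> inv (gcomm G x y) = gcomm G y x"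
  by (simp add: word_simps)

text \<open>An identity of the free group on three generators; it drives the three-subgroups
  argument in \<open>rel_lower_central_gcomm\<close>.\<close>

lemma Hall_Witt:
  assumes "x \<in> carrier G" "y \<in> carrier G" "z \<in> carrier G"
  shows "gcomm G (gcomm G x y) (y \<otimes> z \<otimes> inv y) \<otimes> gcomm G (gcomm G y z) (z \<otimes> x \<otimes> inv z) \<otimes>
    gcomm G (gcomm G z x) (x \<otimes> y \<otimes> inv x) = \<one>"
  using assms by (simp add: word_simps)

lemma normal_conj_closed: "\<lbrakk>N \<lhd> G; g \<in> carrier G; x \<in> N\<rbrakk> \<Longrightarrow> g \<otimes> x \<otimes> inv g \<in> N"
  by (rule normal.inv_op_closed2)

lemma normal_conj_closed': "\<lbrakk>N \<lhd> G; g \<in> carrier G; x \<in> N\<rbrakk> \<Longrightarrow> inv g \<otimes> x \<otimes> g \<in> N"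
  by (rule normal.inv_op_closed1)

lemma normal_carrier: "\<lbrakk>N \<lhd> G; x \<in> N\<rbrakk> \<Longrightarrow> x \<in> carrier G"
  by (rule subgroup.mem_carrier[OF normal_imp_subgroup])

lemma normal_gcomm_left:
  assumes "N \<lhd> G" "x \<in> N" "y \<in> carrier G"
  shows "gcomm G x y \<in> N"
proof -
  note sg = normal_imp_subgroup[OF assms(1)]
  have x: "x \<in> carrier G" by (rule normal_carrier[OF assms(1,2)])
  have "y \<otimes> inv x \<otimes> inv y \<in> N"
    by (rule normal_conj_closed[OF assms(1,3) subgroup.m_inv_closed[OF sg assms(2)]])
  then have "x \<otimes> (y \<otimes> inv x \<otimes> inv y) \<in> N"
    by (rule subgroup.m_closed[OF sg assms(2)])
  then show ?thesis using x assms(3) by (simp add: word_simps)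
qed

lemma normal_gcomm_right:
  assumes "N \<lhd> G" "x \<in> carrier G" "y \<in> N"
  shows "gcomm G x y \<in> N"
proof -
  have "inv (gcomm G y x) \<in> N"
    by (rule subgroup.m_inv_closed[OF normal_imp_subgroup[OF assms(1)]
          normal_gcomm_left[OF assms(1,3,2)]])
  then show ?thesis using inv_gcomm[OF normal_carrier[OF assms(1,3)] assms(2)] by simp
qed

text \<open>This set is the preimage of the centralizer of the image of \<open>B\<close> in
  \<open>G / L\<close>. It allows commutator inclusions to be tested on generators.\<close>

lemma subgroup_gcomm_into:
  assumes L: "L \<lhd> G" and B: "B \<subseteq> carrier G"
  shows "subgroup {x \<in> carrier G. \<forall>y \<in> B. gcomm G x y \<in> L} G"
proof (rule subgroupI)
  have sg: "subgroup L G" by (rule normal_imp_subgroup[OF L])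
  have "gcomm G \<one> y = \<one>" if "y \<in> carrier G" for y
    using that by (simp add: gcomm_def)
  then show "{x \<in> carrier G. \<forall>y \<in> B. gcomm G x y \<in> L} \<noteq> {}"
    using B subgroup.one_closed[OF sg] by (auto intro!: exI[of _ \<one>])
  fix a assume a: "a \<in> {x \<in> carrier G. \<forall>y \<in> B. gcomm G x y \<in> L}"
  have "gcomm G (inv a) y \<in> L" if "y \<in> B" for y
  proof -
    have "inv a \<otimes> inv (gcomm G a y) \<otimes> a \<in> L"
      using a that by (intro normal_conj_closed'[OF L] subgroup.m_inv_closed[OF sg]) auto
    then show ?thesis using a that B gcomm_inv_left[of a y] by auto
  qed
  then show "inv a \<in> {x \<in> carrier G. \<forall>y \<in> B. gcomm G x y \<in> L}" using a by auto
  fix b assume b: "b \<in> {x \<in> carrier G. \<forall>y \<in> B. gcomm G x y \<in> L}"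
  have "gcomm G (a \<otimes> b) y \<in> L" if "y \<in> B" for y
  proof -
    have "(a \<otimes> gcomm G b y \<otimes> inv a) \<otimes> gcomm G a y \<in> L"
      using a b that by (intro subgroup.m_closed[OF sg] normal_conj_closed[OF L]) auto
    then show ?thesis using a b that B gcomm_mult_left[of a b y] by auto
  qed
  then show "a \<otimes> b \<in> {x \<in> carrier G. \<forall>y \<in> B. gcomm G x y \<in> L}" using a b by auto
qed auto

lemma gcomm_generate_left:
  assumes "L \<lhd> G" "S \<subseteq> carrier G" "B \<subseteq> carrier G"
    and "\<And>x y. \<lbrakk>x \<in> S; y \<in> B\<rbrakk> \<Longrightarrow> gcomm G x y \<in> L"
    and "x \<in> generate G S" "y \<in> B"
  shows "gcomm G x y \<in> L"
proof -
  have "generate G S \<subseteq> {x \<in> carrier G. \<forall>y \<in> B. gcomm G x y \<in> L}"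
    using assms(2,4) by (intro generate_subgroup_incl subgroup_gcomm_into assms(1,3)) auto
  then show ?thesis using assms(5,6) by auto
qed

lemma gcomm_generate_right:
  assumes "L \<lhd> G" "S \<subseteq> carrier G" "x \<in> carrier G"
    and "\<And>y. y \<in> S \<Longrightarrow> gcomm G x y \<in> L" and y: "y \<in> generate G S"
  shows "gcomm G x y \<in> L"
proof -
  have sg: "subgroup L G" by (rule normal_imp_subgroup[OF assms(1)])
  have "gcomm G s z \<in> L" if "s \<in> S" "z \<in> {x}" for s z
    using assms(2-4) that subgroup.m_inv_closed[OF sg assms(4)[OF that(1)]] inv_gcomm[of x s] by auto
  then have "gcomm G y x \<in> L"
    using gcomm_generate_left[OF assms(1,2), of "{x}"] assms(3) y by simp
  then have "inv (gcomm G y x) \<in> L"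
    by (rule subgroup.m_inv_closed[OF sg])
  then show ?thesis using inv_gcomm[OF generate_in_carrier[OF assms(2) y] assms(3)] by simp
qed

lemma normal_gcomm_into:
  assumes L: "L \<lhd> G" and N: "N \<lhd> G"
  shows "{x \<in> carrier G. \<forall>y \<in> N. gcomm G x y \<in> L} \<lhd> G"
proof (rule normal_invI)
  show "subgroup {x \<in> carrier G. \<forall>y \<in> N. gcomm G x y \<in> L} G"
    using normal_carrier[OF N] by (intro subgroup_gcomm_into L) auto
  fix g x assume g: "g \<in> carrier G" and x: "x \<in> {x \<in> carrier G. \<forall>y \<in> N. gcomm G x y \<in> L}"
  have "gcomm G (g \<otimes> x \<otimes> inv g) y \<in> L" if y: "y \<in> N" for y
  proof -
    have yc: "y \<in> carrier G" using normal_carrier[OF N y] .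
    have "inv g \<otimes> y \<otimes> g \<in> N" using normal_conj_closed'[OF N g y] .
    then have "g \<otimes> gcomm G x (inv g \<otimes> y \<otimes> g) \<otimes> inv g \<in> L"
      using x by (intro normal_conj_closed[OF L g]) auto
    moreover have "g \<otimes> gcomm G x (inv g \<otimes> y \<otimes> g) \<otimes> inv g = gcomm G (g \<otimes> x \<otimes> inv g) y"
      using x g yc by (simp add: word_simps)
    ultimately show ?thesis by simp
  qed
  then show "g \<otimes> x \<otimes> inv g \<in> {x \<in> carrier G. \<forall>y \<in> N. gcomm G x y \<in> L}"
    using x g by auto
qed

end

text \<open>Term \<open>i\<close> consists of the \<open>x\<close> in \<open>G\<close> with
  \<open>[x, y1, ..., yi]\<close> in \<open>L\<close> for all \<open>y1, ..., yi\<close> in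
  \<open>N\<close>. For \<open>N = carrier G\<close> it is the pulled-back upper central series of
  \<open>G / L\<close>; for \<open>L = {\<one>}\<close>, \<open>N\<close> contained in term
  \<open>n\<close> means that \<open>N\<close> is nilpotent of class at most
  \<open>n\<close>.\<close>

primrec rel_upper_central :: "('a, 'm) monoid_scheme \<Rightarrow> 'a set \<Rightarrow> 'a set \<Rightarrow> nat \<Rightarrow> 'a set"
  where
    "rel_upper_central G L N 0 = L"
  | "rel_upper_central G L N (Suc i) = {x \<in> carrier G. \<forall>y \<in> N. gcomm G x y \<in> rel_upper_central G L N i}"

text \<open>Index \<open>0\<close> is the whole group, so that translates of elements of \<open>N\<close> are polynomial in the
  filtration below.\<close>

fun rel_lower_central :: "('a, 'm) monoid_scheme \<Rightarrow> 'a set \<Rightarrow> nat \<Rightarrow> 'a set"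
  where
    "rel_lower_central G N 0 = carrier G"
  | "rel_lower_central G N (Suc 0) = N"
  | "rel_lower_central G N (Suc (Suc i)) =
      generate G {gcomm G x y | x y. x \<in> rel_lower_central G N (Suc i) \<and> y \<in> N}"

text \<open>The case \<open>j = 0\<close> of \<open>H_gcomm\<close> expresses that every term is
  normal. With \<open>H 0\<close> the whole group, any map into \<open>G\<close> may serve as a
  starting point of index \<open>0\<close>.\<close>

locale group_filtration = group G for G (structure) +
  fixes H :: "nat \<Rightarrow> 'a set"
  assumes H_0: "H 0 = carrier G"
    and H_subgroup: "subgroup (H i) G"
    and H_Suc: "H (Suc i) \<subseteq> H i"
    and H_gcomm: "\<lbrakk>a \<in> H i; b \<in> H j\<rbrakk> \<Longrightarrow> gcomm G a b \<in> H (i + j)"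

context group
begin

lemma normal_rel_upper_central: "\<lbrakk>L \<lhd> G; N \<lhd> G\<rbrakk> \<Longrightarrow> rel_upper_central G L N i \<lhd> G"
  by (induction i) (simp_all add: normal_gcomm_into)

lemma normal_rel_lower_central:
  assumes N: "N \<lhd> G"
  shows "rel_lower_central G N i \<lhd> G"
proof (induction i)
  case (Suc i')
  show ?case
  proof (cases i')
    case (Suc i)
    note IH = Suc.IH[unfolded Suc]
    show ?thesis
      unfolding Suc rel_lower_central.simps
    proof (rule normal_generateI)
      show "{gcomm G x y | x y. x \<in> rel_lower_central G N (Suc i) \<and> y \<in> N} \<subseteq> carrier G"
        using normal_carrier[OF N] normal_carrier[OF IH] by auto
      fix h g assume "h \<in> {gcomm G x y | x y. x \<in> rel_lower_central G N (Suc i) \<and> y \<in> N}"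
        and g: "g \<in> carrier G"
      then obtain x y where h: "h = gcomm G x y" "x \<in> rel_lower_central G N (Suc i)" "y \<in> N" by auto
      then have "g \<otimes> h \<otimes> inv g = gcomm G (g \<otimes> x \<otimes> inv g) (g \<otimes> y \<otimes> inv g)"
        using g normal_carrier[OF N] normal_carrier[OF IH] by (auto intro: gcomm_conj)
      then show "g \<otimes> h \<otimes> inv g \<in> {gcomm G x y | x y. x \<in> rel_lower_central G N (Suc i) \<and> y \<in> N}"
        using normal_conj_closed[OF N g h(3)] normal_conj_closed[OF IH g h(2)] by blast
    qed
  qed (use N in simp)
qed (simp add: normal_self)

text \<open>Three-subgroups argument by induction on \<open>j\<close>, with \<open>i\<close> and
  \<open>a\<close> general. For a generator \<open>[x, n]\<close> of the second term, the Hall-Witt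
  identity expresses its commutator with \<open>a\<close> through \<open>[[n, z], x']\<close> and
  \<open>[[z, x], n']\<close>, where \<open>x'\<close>, \<open>n'\<close> are conjugates of
  \<open>x\<close>, \<open>n\<close>. The induction hypothesis covers the first at the larger index
  \<open>Suc i\<close>; the second follows from the definition of the series.\<close>

lemma rel_lower_central_gcomm:
  assumes N: "N \<lhd> G"
  shows "\<lbrakk>a \<in> rel_lower_central G N i; x \<in> rel_lower_central G N (Suc j)\<rbrakk> \<Longrightarrow>
    gcomm G a x \<in> rel_lower_central G N (i + Suc j)"
proof (induction j arbitrary: i a x)
  case 0
  then have "a \<in> carrier G" using normal_carrier[OF normal_rel_lower_central[OF N] 0(1)] by simp
  show ?case
  proof (cases i)
    case 0
    then show ?thesis using \<open>a \<in> carrier G\<close> 0 \<open>x \<in> _\<close> normal_gcomm_right[OF N] by simp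
  next
    case (Suc k)
    then show ?thesis using \<open>a \<in> rel_lower_central G N i\<close> \<open>x \<in> _\<close> by (auto intro!: generate.incl)
  qed
next
  case (Suc j)
  let ?H = "rel_lower_central G N"
  let ?L = "?H (i + Suc (Suc j))"
  have L: "?L \<lhd> G" by (rule normal_rel_lower_central[OF N])
  note L_sub = normal_imp_subgroup[OF L]
  have car: "y \<in> carrier G" if "y \<in> ?H k" for y k
    using normal_carrier[OF normal_rel_lower_central[OF N] that] .
  have a: "a \<in> carrier G" by (rule car[OF Suc.prems(1)])
  have "gcomm G a s \<in> ?L" if s_in: "s \<in> {gcomm G x y | x y. x \<in> ?H (Suc j) \<and> y \<in> N}" for s
  proof -
    obtain x n where s: "s = gcomm G x n" and x: "x \<in> ?H (Suc j)" and n: "n \<in> N"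
      using s_in by auto
    have c: "x \<in> carrier G" "n \<in> carrier G" using car[OF x] normal_carrier[OF N n] by auto
    \<comment> \<open>Chosen so that the first Hall-Witt factor, whose second entry is conjugated by
      \<open>n\<close>, becomes \<open>gcomm G s a\<close>.\<close>
    define z where "z = inv n \<otimes> a \<otimes> n"
    have z: "z \<in> ?H i"
      unfolding z_def by (rule normal_conj_closed'[OF normal_rel_lower_central[OF N] c(2) Suc.prems(1)])
    have zc: "z \<in> carrier G" by (rule car[OF z])
    have a_z: "a = n \<otimes> z \<otimes> inv n" using a c by (simp add: z_def word_simps)
    have n1: "n \<in> ?H (Suc 0)" using n by simp
    have zn: "gcomm G z n \<in> ?H (Suc i)" 
    proof (cases i)
      case 0
      then show ?thesis using normal_gcomm_right[OF N zc n] by simp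
    next
      case (Suc k)
      then show ?thesis using z n by (auto intro!: generate.incl)
    qed
    then have "gcomm G n z \<in> ?H (Suc i)"
      using inv_gcomm[OF zc c(2)]
        subgroup.m_inv_closed[OF normal_imp_subgroup[OF normal_rel_lower_central[OF N]] zn]
      by simp
    moreover have "z \<otimes> x \<otimes> inv z \<in> ?H (Suc j)"
      by (rule normal_conj_closed[OF normal_rel_lower_central[OF N] zc x])
    ultimately have 1: "gcomm G (gcomm G n z) (z \<otimes> x \<otimes> inv z) \<in> ?L"
      using Suc.IH[of "gcomm G n z" "Suc i"] by simp
    have "gcomm G z x \<in> ?H (i + Suc j)" by (rule Suc.IH[OF z x])
    moreover have "x \<otimes> n \<otimes> inv x \<in> N" by (rule normal_conj_closed[OF N c(1) n])
    ultimately have 2: "gcomm G (gcomm G z x) (x \<otimes> n \<otimes> inv x) \<in> ?L"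
      by (auto intro!: generate.incl)
    define p q where "p = gcomm G (gcomm G n z) (z \<otimes> x \<otimes> inv z)"
      and "q = gcomm G (gcomm G z x) (x \<otimes> n \<otimes> inv x)"
    have pq: "p \<in> ?L" "q \<in> ?L" "p \<in> carrier G" "q \<in> carrier G"
      using 1 2 zc c by (auto simp: p_def q_def)
    have sc: "s \<in> carrier G" using c s by simp
    have gs: "gcomm G s a \<in> carrier G" using sc a by simp
    have "gcomm G s a \<otimes> p \<otimes> q = \<one>"
      using Hall_Witt[OF c zc] by (simp add: s p_def q_def a_z)
    then have "gcomm G s a \<otimes> (p \<otimes> q) = \<one>"
      using m_assoc[OF gs pq(3,4)] by simp
    from inv_equality[OF this m_closed[OF pq(3,4)] gs]
    have "inv (gcomm G s a) = p \<otimes> q"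
      using pq(3,4) by (metis inv_inv m_closed)
    then show ?thesis
      using pq subgroup.m_closed[OF L_sub pq(1,2)] inv_gcomm[OF sc a] by simp
  qed
  note gens = this
  have "{gcomm G x y | x y. x \<in> ?H (Suc j) \<and> y \<in> N} \<subseteq> carrier G"
    using car normal_carrier[OF N] by auto
  from gcomm_generate_right[OF L this a gens, of x] show ?case
    using Suc.prems(2) by simp
qed

lemma group_filtration_rel_lower_central:
  assumes N: "N \<lhd> G"
  shows "group_filtration G (rel_lower_central G N)"
proof (intro group_filtration.intro group_filtration_axioms.intro is_group)
  let ?H = "rel_lower_central G N"
  show "subgroup (?H i) G" for i by (rule normal_imp_subgroup[OF normal_rel_lower_central[OF N]])
  have car: "y \<in> carrier G" if "y \<in> ?H k" for y k
    using normal_carrier[OF normal_rel_lower_central[OF N] that] .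
  show "?H (Suc i) \<subseteq> ?H i" for i
  proof (cases i)
    case (Suc k)
    have "gcomm G x y \<in> ?H (Suc k)" if "x \<in> ?H (Suc k)" "y \<in> N" for x y
      by (rule normal_gcomm_left[OF normal_rel_lower_central[OF N] that(1) normal_carrier[OF N that(2)]])
    then have "generate G {gcomm G x y | x y. x \<in> ?H (Suc k) \<and> y \<in> N} \<subseteq> ?H (Suc k)"
      by (intro generate_subgroup_incl normal_imp_subgroup normal_rel_lower_central N) auto
    then show ?thesis using Suc by simp
  qed (use normal_carrier[OF N] in auto)
  show "gcomm G a b \<in> ?H (i + j)" if "a \<in> ?H i" "b \<in> ?H j" for a b i j
  proof (cases j)
    case 0
    then show ?thesis
      using that normal_gcomm_left[OF normal_rel_lower_central[OF N]] by simp
  next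
    case (Suc k)
    then show ?thesis using rel_lower_central_gcomm[OF N that(1), of b k] that(2) by simp
  qed
qed simp

text \<open>Each commutation with \<open>N\<close> goes one step down the upper series and one step
  along the lower one. At \<open>i = n\<close> a lower term lands in \<open>L\<close>, which
  converts nilpotency into a small filtration term.\<close>

lemma rel_lower_central_subset_upper:
  assumes "L \<lhd> G" "N \<lhd> G" "N \<subseteq> rel_upper_central G L N n"
  shows "i \<le> n \<Longrightarrow> rel_lower_central G N (Suc i) \<subseteq> rel_upper_central G L N (n - i)"
proof (induction i)
  case (Suc i)
  have "gcomm G x y \<in> rel_upper_central G L N (n - Suc i)"
    if "x \<in> rel_lower_central G N (Suc i)" "y \<in> N" for x y
  proof -
    have "n - i = Suc (n - Suc i)" using Suc.prems by simp
    moreover have "x \<in> rel_upper_central G L N (n - i)" using that Suc by auto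
    ultimately show ?thesis using that by auto
  qed
  then have "generate G {gcomm G x y | x y. x \<in> rel_lower_central G N (Suc i) \<and> y \<in> N}
      \<subseteq> rel_upper_central G L N (n - Suc i)"
    by (intro generate_subgroup_incl normal_imp_subgroup normal_rel_upper_central assms(1,2)) auto
  then show ?case by simp
qed (use assms in simp)

text \<open>A commutator of a \<gamma>-value with any element is a \<gamma>-value with one more
  entry, so entries can be removed one at a time. At \<open>i = n\<close> the whole group lies in
  the upper series of \<open>G / L\<close>.\<close>

lemma gamma_values_rel_upper_central:
  assumes "gamma_values G n \<subseteq> L"
  shows "i \<le> n \<Longrightarrow> gamma_values G (n - i) \<subseteq> rel_upper_central G L (carrier G) i"
proof (induction i)
  case (Suc i)
  have "n - i = Suc (n - Suc i)" using Suc.prems by simp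
  then show ?case using Suc gamma_values_closed[of "n - Suc i"] by auto
qed (use assms in simp)

end

section \<open>Polynomial maps\<close>

text \<open>The domain and its shifts are abstract because two cases are needed: boxes of cosets
  with right translations by \<open>N\<close>, and the natural numbers with
  \<open>Suc\<close>.\<close>

locale polynomial_maps = group_filtration +
  fixes X :: "'x set" and \<Sigma> :: "('x \<Rightarrow> 'x) set"
  assumes shift_closed: "\<lbrakk>\<sigma> \<in> \<Sigma>; x \<in> X\<rbrakk> \<Longrightarrow> \<sigma> x \<in> X"
begin

definition diff_map :: "('x \<Rightarrow> 'x) \<Rightarrow> ('x \<Rightarrow> 'a) \<Rightarrow> 'x \<Rightarrow> 'a"
  where "diff_map \<sigma> f x = inv (f x) \<otimes> f (\<sigma> x)"

text \<open>A truncated form of Leibman's notion: iterated differences of order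
  \<open>k \<le> m\<close> take values in \<open>H (i + k)\<close>. Vanishing is not built in; it
  results when \<open>H (i + m)\<close> is trivial, and finiteness of that term is enough for the
  arguments below.\<close>

primrec poly_map :: "nat \<Rightarrow> nat \<Rightarrow> ('x \<Rightarrow> 'a) \<Rightarrow> bool"
  where
    "poly_map 0 i f \<longleftrightarrow> (\<forall>x \<in> X. f x \<in> H i)"
  | "poly_map (Suc m) i f \<longleftrightarrow>
      (\<forall>x \<in> X. f x \<in> H i) \<and> (\<forall>\<sigma> \<in> \<Sigma>. poly_map m (Suc i) (diff_map \<sigma> f))"

lemma H_carrier: "a \<in> H i \<Longrightarrow> a \<in> carrier G"
  by (rule subgroup.mem_carrier[OF H_subgroup])

lemma poly_map_in: "\<lbrakk>poly_map m i f; x \<in> X\<rbrakk> \<Longrightarrow> f x \<in> H i"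
  by (cases m) auto

lemma poly_map_closed: "\<lbrakk>poly_map m i f; x \<in> X\<rbrakk> \<Longrightarrow> f x \<in> carrier G"
  using poly_map_in H_carrier by blast

lemma poly_map_cong: "\<lbrakk>poly_map m i f; \<And>x. x \<in> X \<Longrightarrow> f x = g x\<rbrakk> \<Longrightarrow> poly_map m i g"
proof (induction m arbitrary: i f g)
  case 0
  then show ?case by simp
next
  case (Suc m)
  have "poly_map m (Suc i) (diff_map \<sigma> g)" if s: "\<sigma> \<in> \<Sigma>" for \<sigma>
  proof (rule Suc.IH)
    show "poly_map m (Suc i) (diff_map \<sigma> f)" using Suc.prems(1) s by simp
    show "diff_map \<sigma> f x = diff_map \<sigma> g x" if "x \<in> X" for x
      using Suc.prems(2)[OF that] Suc.prems(2)[OF shift_closed[OF s that]] by (simp add: diff_map_def)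
  qed
  then show ?case using Suc.prems by simp
qed

lemma poly_map_Suc: "poly_map (Suc m) i f \<Longrightarrow> poly_map m i f"
  by (induction m arbitrary: i f) auto

lemma poly_map_antimono_Suc: "poly_map m (Suc i) f \<Longrightarrow> poly_map m i f"
proof (induction m arbitrary: i f)
  case 0
  then show ?case using subsetD[OF H_Suc] by simp
next
  case (Suc m)
  then show ?case using subsetD[OF H_Suc] by simp
qed

lemma poly_map_antimono: "\<lbrakk>i \<le> j; poly_map m j f\<rbrakk> \<Longrightarrow> poly_map m i f"
  by (induction rule: inc_induct) (auto intro: poly_map_antimono_Suc)

lemma poly_map_one: "poly_map m i (\<lambda>_. \<one>)"
proof (induction m arbitrary: i)
  case (Suc m)
  have "diff_map \<sigma> (\<lambda>_. \<one>) = (\<lambda>_. \<one>)" for \<sigma> by (auto simp: diff_map_def)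
  then show ?case using Suc subgroup.one_closed[OF H_subgroup] by simp
qed (simp add: subgroup.one_closed[OF H_subgroup])

lemma poly_map_const: "c \<in> H i \<Longrightarrow> poly_map m i (\<lambda>_. c)"
proof (induction m)
  case (Suc m)
  have "diff_map \<sigma> (\<lambda>_. c) = (\<lambda>_. \<one>)" for \<sigma>
    using H_carrier[OF Suc.prems] by (auto simp: diff_map_def)
  then show ?case using Suc.prems poly_map_one by simp
qed simp

text \<open>The Lazard--Leibman theorem. The closure properties are proved together because the
  difference of a product involves commutators.\<close>

lemma poly_map_group:
  "(\<forall>i f g. poly_map m i f \<longrightarrow> poly_map m i g \<longrightarrow> poly_map m i (\<lambda>x. f x \<otimes> g x)) \<and>
   (\<forall>i f. poly_map m i f \<longrightarrow> poly_map m i (\<lambda>x. inv (f x))) \<and>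
   (\<forall>i j f g. poly_map m i f \<longrightarrow> poly_map m j g \<longrightarrow> poly_map m (i + j) (\<lambda>x. gcomm G (f x) (g x)))"
proof (induction m)
  case 0
  show ?case
    using subgroup.m_closed[OF H_subgroup] subgroup.m_inv_closed[OF H_subgroup] H_gcomm by auto
next
  case (Suc m)
  have mult: "poly_map m i (\<lambda>x. f x \<otimes> g x)" if "poly_map m i f" "poly_map m i g" for i f g
    using Suc that by blast
  have inv: "poly_map m i (\<lambda>x. inv (f x))" if "poly_map m i f" for i f
    using Suc that by blast
  have comm: "poly_map m (i + j) (\<lambda>x. gcomm G (f x) (g x))"
    if "poly_map m i f" "poly_map m j g" for i j f g
    using Suc that by blast
  have conj: "poly_map m l (\<lambda>x. f x \<otimes> F x \<otimes> inv (f x))" if f: "poly_map m i f" and F: "poly_map m l F"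
    for i l f F
  proof -
    \<comment> \<open>A conjugate is the product of \<open>[f, F]\<close> and \<open>F\<close>, and
      the commutator has index \<open>i + l\<close>, hence also index \<open>l\<close>.\<close>
    have "poly_map m l (\<lambda>x. gcomm G (f x) (F x))"
      by (rule poly_map_antimono[OF _ comm[OF f F]]) simp
    from mult[OF this F] show ?thesis
      by (rule poly_map_cong) (use poly_map_closed f F in \<open>auto simp: word_simps\<close>)
  qed
  have conj': "poly_map m l (\<lambda>x. inv (f x) \<otimes> F x \<otimes> f x)" if f: "poly_map m i f" and F: "poly_map m l F"
    for i l f F
    by (rule poly_map_cong[OF conj[OF inv[OF f] F]]) (use poly_map_closed[OF f] in auto)
  have diff: "poly_map m (Suc i) (diff_map \<sigma> f)" if "poly_map (Suc m) i f" "\<sigma> \<in> \<Sigma>" for i f \<sigma>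
    using that by simp
  have cl: "f x \<in> carrier G" "f (\<sigma> x) \<in> carrier G"
    if "poly_map (Suc m) i f" "\<sigma> \<in> \<Sigma>" "x \<in> X" for i f \<sigma> x
    using poly_map_closed[OF that(1)] shift_closed[OF that(2,3)] that(3) by auto
  show ?case
  proof (intro conjI allI impI)
    fix i f g assume f: "poly_map (Suc m) i f" and g: "poly_map (Suc m) i g"
    have "poly_map m (Suc i) (diff_map \<sigma> (\<lambda>x. f x \<otimes> g x))" if s: "\<sigma> \<in> \<Sigma>" for \<sigma>
      by (rule poly_map_cong[OF mult[OF conj'[OF poly_map_Suc[OF g] diff[OF f s]] diff[OF g s]]])
        (use cl[OF f s] cl[OF g s] in \<open>simp add: diff_map_def word_simps\<close>)
    then show "poly_map (Suc m) i (\<lambda>x. f x \<otimes> g x)"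
      using subgroup.m_closed[OF H_subgroup] poly_map_in[OF f] poly_map_in[OF g] by simp
  next
    fix i f assume f: "poly_map (Suc m) i f"
    have "poly_map m (Suc i) (diff_map \<sigma> (\<lambda>x. inv (f x)))" if s: "\<sigma> \<in> \<Sigma>" for \<sigma>
      by (rule poly_map_cong[OF conj[OF poly_map_Suc[OF f] inv[OF diff[OF f s]]]])
        (use cl[OF f s] in \<open>simp add: diff_map_def word_simps\<close>)
    then show "poly_map (Suc m) i (\<lambda>x. inv (f x))"
      using subgroup.m_inv_closed[OF H_subgroup] poly_map_in[OF f] by simp
  next
    fix i j f g assume f: "poly_map (Suc m) i f" and g: "poly_map (Suc m) j g"
    note f0 = poly_map_Suc[OF f] and g0 = poly_map_Suc[OF g]
    have "poly_map m (Suc (i + j)) (diff_map \<sigma> (\<lambda>x. gcomm G (f x) (g x)))" if s: "\<sigma> \<in> \<Sigma>" for \<sigma>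
    proof -
      note F = diff[OF f s] and E = diff[OF g s]
      have gE: "poly_map m j (\<lambda>x. g x \<otimes> diff_map \<sigma> g x)"
        by (rule mult[OF g0 poly_map_antimono_Suc[OF E]])
      have 1: "poly_map m (Suc (i + j)) (\<lambda>x. gcomm G (diff_map \<sigma> f x) (g x \<otimes> diff_map \<sigma> g x))"
        using comm[OF F gE] by simp
      have 2: "poly_map m (Suc (i + j)) (\<lambda>x. gcomm G (f x) (diff_map \<sigma> g x))"
        using comm[OF f0 E] by simp
      \<comment> \<open>With \<open>F\<close>, \<open>E\<close> the differences of \<open>f\<close>,
        \<open>g\<close>, expanding \<open>[f F, g E]\<close> in both entries and cancelling
        \<open>[f, g]\<close> leaves conjugates of \<open>[F, g E]\<close> and
        \<open>[f, E]\<close>. Each contains a difference, which accounts for the extra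
        \<open>Suc\<close> in the index.\<close>
      from mult[OF conj'[OF comm[OF f0 g0] conj[OF f0 1]] conj[OF g0 2]]
      show ?thesis
        by (rule poly_map_cong) (use cl[OF f s] cl[OF g s] in \<open>simp add: diff_map_def word_simps\<close>)
    qed
    then show "poly_map (Suc m) (i + j) (\<lambda>x. gcomm G (f x) (g x))"
      using H_gcomm poly_map_in[OF f] poly_map_in[OF g] by simp
  qed
qed

lemma poly_map_word_eval:
  assumes "\<And>i. i \<in> fst ` set w \<Longrightarrow> poly_map m 0 (\<lambda>x. g x i)"
  shows "poly_map m 0 (\<lambda>x. word_eval G (g x) w)"
  using assms
proof (induction w)
  case Nil
  show ?case using poly_map_one by (simp add: word_eval_def)
next
  case (Cons a w)
  have IH: "poly_map m 0 (\<lambda>x. word_eval G (g x) w)" using Cons by simp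
  have a: "poly_map m 0 (\<lambda>x. g x (fst a))" using Cons.prems by simp
  then have "poly_map m 0 (\<lambda>x. if snd a then g x (fst a) else inv (g x (fst a)))"
    using poly_map_group by (cases "snd a") auto
  then have "poly_map m 0 (\<lambda>x. (if snd a then g x (fst a) else inv (g x (fst a))) \<otimes> word_eval G (g x) w)"
    using IH poly_map_group by blast
  then show ?case by (simp add: word_eval_def case_prod_beta)
qed

end

section \<open>Finite conjugacy classes and polynomial sequences\<close>

context group
begin

definition conj_class :: "'a \<Rightarrow> 'a set"
  where "conj_class x = {g \<otimes> x \<otimes> inv g | g. g \<in> carrier G}"

text \<open>Elements with finitely many conjugates form a subgroup, since the class of a product
  lies in the product of the classes.\<close>

lemma finite_conj_class_generate:
  assumes "finite S" "conj_closed S" "x \<in> generate G S"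
  shows "finite (conj_class x)"
  using assms(3)
proof induction
  case one
  have "conj_class \<one> \<subseteq> {\<one>}" by (auto simp: conj_class_def)
  then show ?case using finite_subset by blast
next
  case (incl s)
  have "conj_class s \<subseteq> S" using conj_closedD[OF assms(2) incl] by (auto simp: conj_class_def)
  then show ?case using assms(1) finite_subset by blast
next
  case (inv s)
  have "g \<otimes> inv s \<otimes> inv g \<in> (\<lambda>x. inv x) ` S" if "g \<in> carrier G" for g
  proof -
    have "g \<otimes> inv s \<otimes> inv g = inv (g \<otimes> s \<otimes> inv g)"
      using that conj_closedD(1)[OF assms(2) inv] by (simp add: word_simps)
    then show ?thesis using conj_closedD(2)[OF assms(2) inv that] by blast
  qed
  then have "conj_class (inv s) \<subseteq> (\<lambda>x. inv x) ` S" by (auto simp: conj_class_def)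
  then show ?case using assms(1) finite_surj by blast
next
  case (eng x y)
  have c: "x \<in> carrier G" "y \<in> carrier G"
    using eng generate_in_carrier[of S] conj_closedD(1)[OF assms(2)] by auto
  have "g \<otimes> (x \<otimes> y) \<otimes> inv g \<in> (\<lambda>(a, b). a \<otimes> b) ` (conj_class x \<times> conj_class y)"
    if "g \<in> carrier G" for g
  proof -
    have "g \<otimes> (x \<otimes> y) \<otimes> inv g = (g \<otimes> x \<otimes> inv g) \<otimes> (g \<otimes> y \<otimes> inv g)"
      using that c by (simp add: word_simps)
    then show ?thesis using that by (force simp: conj_class_def)
  qed
  then have "conj_class (x \<otimes> y) \<subseteq> (\<lambda>(a, b). a \<otimes> b) ` (conj_class x \<times> conj_class y)"
    by (auto simp: conj_class_def[of "x \<otimes> y"])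
  then show ?case using eng.IH finite_surj finite_cartesian_product by blast
qed

lemma torsion_finite_subgroup:
  assumes "subgroup L G" "finite L" "x \<in> L"
  shows "\<exists>k::nat>0. x [^] k = \<one>"
proof -
  have "x [^] n \<in> L" for n :: nat by (rule subgroup_nat_pow_closed[OF assms(1,3)])
  then show ?thesis
    using finite_range_torsion[OF subgroup.mem_carrier[OF assms(1,3)] assms(2)] by metis
qed

end

locale polynomial_sequences = polynomial_maps G H "UNIV :: nat set" "{Suc}" for G (structure) and H
begin

text \<open>By induction on the degree the second differences are torsion, so their conjugates generate
  a finite normal subgroup \<open>L\<close>; modulo \<open>L\<close> the sequence is \<open>f(0) a\<^sup>s\<close> and takes finitely many
  values.\<close>

lemma torsion_diff:
  assumes "finite S" "conj_closed S"
  shows "\<lbrakk>poly_map m i f; finite (H (i + m)); finite (range f); range f \<subseteq> generate G S\<rbrakk> \<Longrightarrow>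
    \<exists>k::nat>0. diff_map Suc f s [^] k = \<one>"
proof (induction m arbitrary: i f s)
  case 0
  then have "diff_map Suc f s \<in> H i"
    using subgroup.m_closed[OF H_subgroup] subgroup.m_inv_closed[OF H_subgroup]
    by (auto simp: diff_map_def)
  then show ?case using torsion_finite_subgroup[OF H_subgroup] 0(2) by simp
next
  case (Suc m)
  define F where "F = diff_map Suc f"
  have Ssub: "S \<subseteq> carrier G" using conj_closedD(1)[OF assms(2)] by auto
  have fc: "f t \<in> carrier G" for t using Suc.prems(4) generate_in_carrier[OF Ssub] by auto
  have Fc: "F t \<in> carrier G" for t using fc by (simp add: F_def diff_map_def)
  have gen: "subgroup (generate G S) G" by (rule generate_is_subgroup[OF Ssub])
  have F_gen: "F t \<in> generate G S" for t
    unfolding F_def diff_map_def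
    by (intro subgroup.m_closed[OF gen] subgroup.m_inv_closed[OF gen]) (use Suc.prems(4) in auto)
  have range_diff: "finite (range (diff_map Suc h))" if "finite (range h)" for h
  proof -
    have "range (diff_map Suc h) \<subseteq> (\<lambda>(a, b). inv a \<otimes> b) ` (range h \<times> range h)"
    proof (rule image_subsetI)
      fix t
      show "diff_map Suc h t \<in> (\<lambda>(a, b). inv a \<otimes> b) ` (range h \<times> range h)"
        by (rule image_eqI[of _ _ "(h t, h (Suc t))"]) (simp_all add: diff_map_def)
    qed
    then show ?thesis by (rule finite_surj[OF finite_cartesian_product[OF that that]])
  qed
  have finF: "finite (range F)" using range_diff[OF Suc.prems(3)] by (simp add: F_def)
  \<comment> \<open>The second differences take finitely many values, all in
    \<open>generate G S\<close>, where conjugacy classes are finite; so adding the conjugates keeps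
    \<open>T\<close> finite.\<close>
  define T where "T = (\<Union>t. conj_class (diff_map Suc F t))"
  have DF_gen: "diff_map Suc F t \<in> generate G S" for t
    unfolding diff_map_def
    by (intro subgroup.m_closed[OF gen] subgroup.m_inv_closed[OF gen]) (rule F_gen)+
  have DFc: "diff_map Suc F t \<in> carrier G" for t by (simp add: diff_map_def Fc)
  have IH: "\<exists>k::nat>0. diff_map Suc F t [^] k = \<one>" for t
    using Suc.prems finF F_gen by (intro Suc.IH[of "Suc i"]) (auto simp: F_def)
  have "finite (\<Union>y \<in> range (diff_map Suc F). conj_class y)"
    using range_diff[OF finF] finite_conj_class_generate[OF assms DF_gen] by blast
  then have "finite T"
    by (simp add: T_def image_image)
  moreover have T: "conj_closed T"
    unfolding conj_closed_def
  proof (intro conjI ballI)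
    show "T \<subseteq> carrier G" using DFc by (auto simp: T_def conj_class_def)
    fix g x assume g: "g \<in> carrier G" and "x \<in> T"
    then obtain t h where h: "h \<in> carrier G" "x = h \<otimes> diff_map Suc F t \<otimes> inv h"
      by (auto simp: T_def conj_class_def)
    then have "g \<otimes> x \<otimes> inv g = (g \<otimes> h) \<otimes> diff_map Suc F t \<otimes> inv (g \<otimes> h)"
      using g DFc[of t] by (simp add: word_simps)
    then show "g \<otimes> x \<otimes> inv g \<in> T" using g h by (auto simp: T_def conj_class_def)
  qed
  moreover have "\<exists>e>0. x [^] (e::nat) = \<one>" if "x \<in> T" for x
  proof -
    obtain t h where h: "h \<in> carrier G" "x = h \<otimes> diff_map Suc F t \<otimes> inv h"
      using \<open>x \<in> T\<close> by (auto simp: T_def conj_class_def)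
    obtain k :: nat where k: "k > 0" "diff_map Suc F t [^] k = \<one>" using IH by blast
    have "x [^] k = \<one>" using h k conj_pow[OF DFc h(1)] by simp
    then show ?thesis using k(1) by blast
  qed
  ultimately have finL: "finite (generate G T)" by (rule finite_generate_torsion)
  define L where "L = generate G T"
  have Tsub: "T \<subseteq> carrier G" using conj_closedD(1)[OF T] by auto
  have L: "L \<lhd> G"
    unfolding L_def by (rule normal_generateI[OF Tsub]) (rule conj_closedD(2)[OF T])
  interpret L: normal L G by (rule L)
  define Q where "Q = G Mod L"
  interpret Q: group Q unfolding Q_def by (rule L.factorgroup_is_group)
  define \<pi> where "\<pi> = (\<lambda>a. L #> a)"
  interpret \<pi>: group_hom G Q \<pi>
    by unfold_locales (unfold \<pi>_def Q_def, rule L.r_coset_hom_Mod)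
  have ker: "x \<in> L" if "x \<in> carrier G" "\<pi> x = \<one>\<^bsub>Q\<^esub>" for x
    using that rcos_self[OF that(1) L.subgroup_axioms] by (simp add: \<pi>_def Q_def FactGroup_def)
  have one: "\<pi> x = \<one>\<^bsub>Q\<^esub>" if "x \<in> L" for x
    using coset_join2[OF _ L.subgroup_axioms that] L.subset that by (auto simp: \<pi>_def Q_def FactGroup_def)
  have piF: "\<pi> (F t) = \<pi> (F 0)" for t
  proof (induction t)
    case (Suc t)
    have "diff_map Suc F t \<in> L"
    proof -
      have "diff_map Suc F t = \<one> \<otimes> diff_map Suc F t \<otimes> inv \<one>" using DFc by simp
      then have "diff_map Suc F t \<in> T" unfolding T_def conj_class_def by blast
      then show ?thesis by (simp add: L_def generate.incl)
    qed
    moreover have "F (Suc t) = F t \<otimes> diff_map Suc F t"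
      using Fc by (simp add: diff_map_def cancel_inv)
    ultimately have "\<pi> (F (Suc t)) = \<pi> (F t) \<otimes>\<^bsub>Q\<^esub> \<one>\<^bsub>Q\<^esub>"
      using \<pi>.hom_mult[OF Fc DFc] one by (simp only:)
    then show ?case
      using Suc Q.r_one[OF \<pi>.hom_closed[OF Fc]] by (simp only:)
  qed simp
  have pif: "\<pi> (f t) = \<pi> (f 0) \<otimes>\<^bsub>Q\<^esub> \<pi> (F 0) [^]\<^bsub>Q\<^esub> t" for t :: nat
  proof (induction t)
    case (Suc t)
    have "f (Suc t) = f t \<otimes> F t" using fc by (simp add: F_def diff_map_def cancel_inv)
    then have "\<pi> (f (Suc t)) = \<pi> (f t) \<otimes>\<^bsub>Q\<^esub> \<pi> (F 0)" using fc Fc piF[of t] by simp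
    then show ?case using Suc fc Fc by (simp add: Q.m_assoc)
  qed (use fc in simp)
  \<comment> \<open>A repeated value \<open>f u = f v\<close> cancels in the quotient to equal
    powers of the constant image of \<open>F\<close>. Thus a positive power of \<open>F s\<close>
    lies in the finite group \<open>L\<close>.\<close>
  have "\<not> inj f" using Suc.prems(3) finite_imageD infinite_UNIV_nat by blast
  then obtain u v where "u \<noteq> v" "f u = f v" by (auto simp: inj_def)
  then obtain u v where uv: "u < v" "f u = f v" by (metis nat_neq_iff)
  then have "\<pi> (F 0) [^]\<^bsub>Q\<^esub> u = \<pi> (F 0) [^]\<^bsub>Q\<^esub> v"
    using pif[of u] pif[of v] fc Fc by simp
  then have "\<pi> (F s) [^]\<^bsub>Q\<^esub> (v - u) = \<one>\<^bsub>Q\<^esub>"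
    using Q.torsion_of_pow_eq[OF _ _ uv(1)] Fc piF[of s] by simp
  then have "\<pi> (F s [^] (v - u)) = \<one>\<^bsub>Q\<^esub>"
    using \<pi>.hom_nat_pow Fc by simp
  then have "F s [^] (v - u) \<in> L" using ker Fc by simp
  then obtain k :: nat where "k > 0" "(F s [^] (v - u)) [^] k = \<one>"
    using torsion_finite_subgroup[OF L.subgroup_axioms] finL L_def by blast
  then show ?case
    using uv(1) Fc by (intro exI[of _ "(v - u) * k"]) (auto simp: nat_pow_pow simp flip: F_def)
qed

end

section \<open>Maps with few values\<close>

lemma total_lepoll: "A \<lesssim> B \<or> B \<lesssim> A"
  using ordLeq_total[OF card_of_Well_order card_of_Well_order, of A B]
  unfolding lepoll_def card_of_ordLeq[symmetric] .

text \<open>The smaller factor is absorbed by the larger: if the larger is infinite it is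
  equipollent to its square, otherwise the product is finite.\<close>

lemma lesspoll_Times:
  assumes "A \<prec> C" "B \<prec> C" "infinite C"
  shows "A \<times> B \<prec> C"
proof -
  have *: "D \<times> E \<prec> C" if "D \<prec> C" "E \<prec> C" "D \<lesssim> E" for D :: "'x set" and E :: "'y set"
  proof (cases "finite E")
    case True
    then have "finite (D \<times> E)" using that(3) lepoll_iff_finite_card by (metis eqpoll_iff_finite_card finite_cartesian_product finite_surj lepoll_iff)
    then show ?thesis using assms(3) finite_lesspoll_infinite by blast
  next
    case False
    have "D \<times> E \<lesssim> E \<times> E" using that(3) by (intro times_lepoll_mono) auto
    also have "E \<times> E \<approx> E"
      using card_of_Times_same_infinite[OF False] by (simp add: eqpoll_iff_card_of_ordIso)
    finally show ?thesis using that(2) lesspoll_trans1 by blast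
  qed
  show ?thesis
  proof (cases "A \<lesssim> B")
    case True
    then show ?thesis using * assms by blast
  next
    case False
    then have "B \<times> A \<prec> C" using * assms total_lepoll by blast
    then show ?thesis using times_commute_eqpoll eq_lesspoll_trans by blast
  qed
qed

lemma infinite_nat_sets: "infinite (UNIV :: nat set set)"
  by (simp add: Finite_Set.finite_set)

text \<open>The combined map factors through pairs of values. This passes smallness to differences
  of maps and to products of word values.\<close>

lemma lesspoll_image2:
  assumes "f ` X \<prec> (UNIV :: nat set set)" "g ` X \<prec> (UNIV :: nat set set)"
  shows "(\<lambda>x. h (f x) (g x)) ` X \<prec> (UNIV :: nat set set)"
proof -
  have "(\<lambda>x. h (f x) (g x)) ` X \<subseteq> (\<lambda>(a, b). h a b) ` (f ` X \<times> g ` X)" by auto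
  then have "(\<lambda>x. h (f x) (g x)) ` X \<lesssim> f ` X \<times> g ` X" by (rule subset_image_lepoll)
  then show ?thesis
    using lesspoll_trans1 lesspoll_Times[OF assms infinite_nat_sets] by blast
qed

text \<open>A compact Hausdorff space with fewer than \<open>2\<^bsup>\<aleph>0\<^esup>\<close> points is not perfect, so the image
  has an isolated point; \<open>V\<close> is its preimage.\<close>

lemma constant_on_open:
  assumes "compact_space X" "topspace X \<noteq> {}" "Hausdorff_space Y" "continuous_map X Y f"
    and small: "f ` topspace X \<prec> (UNIV :: nat set set)"
  obtains V v where "openin X V" "V \<noteq> {}" "\<And>x. x \<in> V \<Longrightarrow> f x = v"
proof -
  define S where "S = f ` topspace X"
  define Z where "Z = subtopology Y S"
  have SY: "S \<subseteq> topspace Y" using assms(4) by (auto simp: S_def continuous_map_def)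
  then have topZ: "topspace Z = S" by (auto simp: Z_def)
  have "compactin Y S"
    unfolding S_def using assms(1,4) image_compactin compact_space_def by blast
  then have "compact_space Z" by (simp add: Z_def compact_space_subtopology)
  then have "locally_compact_space Z" by (rule compact_imp_locally_compact_space)
  moreover have "Hausdorff_space Z" using assms(3) by (simp add: Z_def Hausdorff_space_subtopology)
  moreover have "\<not> (UNIV :: real set) \<lesssim> S"
  proof
    assume "(UNIV :: real set) \<lesssim> S"
    then have "(UNIV :: nat set set) \<lesssim> S" using nat_sets_eqpoll_reals lepoll_trans1 by blast
    then show False using small lesspoll_trans1 lesspoll_not_refl unfolding S_def by blast
  qed
  moreover have "S \<noteq> {}" using assms(2) by (simp add: S_def)
  ultimately have "Z derived_set_of S \<noteq> S" using lepoll_perfect_set by blast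
  moreover have "Z derived_set_of S \<subseteq> S" using derived_set_of_subset_topspace[of Z S] topZ by simp
  ultimately obtain y where y: "y \<in> S" "y \<notin> Z derived_set_of S" by blast
  then obtain U where U: "y \<in> U" "openin Z U" "\<And>z. z \<in> S \<Longrightarrow> z \<in> U \<Longrightarrow> z = y"
    using topZ by (auto simp: in_derived_set_of)
  have "continuous_map X Z f"
    unfolding Z_def using assms(4) by (rule continuous_map_into_subtopology) (auto simp: S_def)
  then have "openin X {x \<in> topspace X. f x \<in> U}"
    using U(2) openin_continuous_map_preimage by blast
  moreover have "{x \<in> topspace X. f x \<in> U} \<noteq> {}" using y(1) U(1) by (auto simp: S_def)
  moreover have "f x = y" if "x \<in> {x \<in> topspace X. f x \<in> U}" for x
    using U(3) that by (auto simp: S_def)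
  ultimately show thesis using that by blast
qed

section \<open>Compact groups\<close>

locale group_topology = group G for G (structure) +
  fixes T :: "'a topology"
  assumes topological: "topological_group G T"
begin

lemma topspace_T [simp]: "topspace T = carrier G"
  using topological by (simp add: topological_group_def)

lemma continuous_mult:
  assumes "continuous_map X T f" "continuous_map X T g"
  shows "continuous_map X T (\<lambda>x. f x \<otimes> g x)"
proof -
  have "continuous_map (prod_topology T T) T (\<lambda>(x, y). x \<otimes> y)"
    using topological by (simp add: topological_group_def)
  from continuous_map_compose[OF continuous_map_pairedI[OF assms] this]
  show ?thesis by (simp add: o_def)
qed

lemma continuous_inv:
  assumes "continuous_map X T f"
  shows "continuous_map X T (\<lambda>x. inv (f x))"
proof -
  have "continuous_map T T (\<lambda>x. inv x)"
    using topological by (simp add: topological_group_def)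
  from continuous_map_compose[OF assms this] show ?thesis by (simp add: o_def)
qed

lemma continuous_const: "c \<in> carrier G \<Longrightarrow> continuous_map X T (\<lambda>_. c)"
  by simp

lemma continuous_gcomm:
  assumes "continuous_map X T f" "continuous_map X T g"
  shows "continuous_map X T (\<lambda>x. gcomm G (f x) (g x))"
  unfolding gcomm_def by (intro continuous_mult continuous_inv assms)

lemma continuous_word_eval:
  assumes "\<And>i. i \<in> fst ` set w \<Longrightarrow> continuous_map X T (\<lambda>x. g x i)"
  shows "continuous_map X T (\<lambda>x. word_eval G (g x) w)"
  using assms
proof (induction w)
  case (Cons a w)
  have a: "continuous_map X T (\<lambda>x. g x (fst a))" using Cons.prems by simp
  then have "continuous_map X T (\<lambda>x. if snd a then g x (fst a) else inv (g x (fst a)))"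
    using continuous_inv by (cases "snd a") auto
  moreover have "continuous_map X T (\<lambda>x. word_eval G (g x) w)" using Cons by simp
  ultimately have "continuous_map X T
      (\<lambda>x. (if snd a then g x (fst a) else inv (g x (fst a))) \<otimes> word_eval G (g x) w)"
    by (rule continuous_mult)
  then show ?case by (simp add: word_eval_def case_prod_beta)
qed (simp add: word_eval_def)

lemma openin_preimage:
  "\<lbrakk>continuous_map T T f; openin T U\<rbrakk> \<Longrightarrow> openin T {x \<in> carrier G. f x \<in> U}"
  using openin_continuous_map_preimage[of T T f U] by simp

lemma closedin_preimage:
  "\<lbrakk>continuous_map T T f; closedin T U\<rbrakk> \<Longrightarrow> closedin T {x \<in> carrier G. f x \<in> U}"
  using closedin_continuous_map_preimage[of T T f U] by simp

lemma continuous_translate: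
  "\<lbrakk>a \<in> carrier G; b \<in> carrier G\<rbrakk> \<Longrightarrow> continuous_map T T (\<lambda>x. a \<otimes> x \<otimes> b)"
  by (intro continuous_mult continuous_const continuous_map_id[unfolded id_def])

lemma continuous_left: "a \<in> carrier G \<Longrightarrow> continuous_map T T (\<lambda>x. a \<otimes> x)"
  by (intro continuous_mult continuous_const continuous_map_id[unfolded id_def])

text \<open>The left coset \<open>t N\<close>, written as a preimage under a left translation so
  that openness and closedness follow from continuity.\<close>

definition coset :: "'a set \<Rightarrow> 'a \<Rightarrow> 'a set"
  where "coset N t = {x \<in> carrier G. inv t \<otimes> x \<in> N}"

lemma openin_coset: "\<lbrakk>openin T N; t \<in> carrier G\<rbrakk> \<Longrightarrow> openin T (coset N t)"
  unfolding coset_def by (rule openin_preimage) (auto intro: continuous_left)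

lemma closedin_coset: "\<lbrakk>closedin T N; t \<in> carrier G\<rbrakk> \<Longrightarrow> closedin T (coset N t)"
  unfolding coset_def by (rule closedin_preimage) (auto intro: continuous_left)

lemma closedin_open_subgroup:
  assumes N: "subgroup N G" "openin T N"
  shows "closedin T N"
proof -
  have sub: "N \<subseteq> carrier G" by (rule subgroup.subset[OF N(1)])
  have "carrier G - N = (\<Union>s \<in> carrier G - N. coset N s)"
  proof (intro equalityI subsetI)
    fix x assume x: "x \<in> carrier G - N"
    then have "x \<in> coset N x" using subgroup.one_closed[OF N(1)] by (simp add: coset_def)
    then show "x \<in> (\<Union>s \<in> carrier G - N. coset N s)" using x by blast
  next
    fix x assume "x \<in> (\<Union>s \<in> carrier G - N. coset N s)"
    then obtain s where s: "s \<in> carrier G" "s \<notin> N" and x: "x \<in> carrier G" "inv s \<otimes> x \<in> N"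
      by (auto simp: coset_def)
    have "x \<notin> N"
    proof
      assume "x \<in> N"
      then have "x \<otimes> inv (inv s \<otimes> x) \<in> N"
        using x(2) subgroup.m_closed[OF N(1)] subgroup.m_inv_closed[OF N(1)] by blast
      then show False using s x(1) by (simp add: word_simps)
    qed
    then show "x \<in> carrier G - N" using x by simp
  qed
  moreover have "openin T (\<Union>s \<in> carrier G - N. coset N s)"
    by (intro openin_Union) (use openin_coset[OF N(2)] in auto)
  ultimately show ?thesis using sub by (simp add: closedin_def)
qed

lemma openin_generate:
  assumes V: "openin T V" "\<one> \<in> V"
  shows "openin T (generate G V)"
proof -
  have Vsub: "V \<subseteq> carrier G" using openin_subset[OF V(1)] by simp
  note B = generate_is_subgroup[OF Vsub]
  have "generate G V = (\<Union>b \<in> generate G V. coset V b)"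
  proof (intro equalityI subsetI)
    fix x assume "x \<in> generate G V"
    moreover from this have "x \<in> coset V x"
      using V(2) subgroup.mem_carrier[OF B] by (simp add: coset_def)
    ultimately show "x \<in> (\<Union>b \<in> generate G V. coset V b)" by blast
  next
    fix x assume "x \<in> (\<Union>b \<in> generate G V. coset V b)"
    then obtain b where b: "b \<in> generate G V" "x \<in> carrier G" "inv b \<otimes> x \<in> V"
      by (auto simp: coset_def)
    then have "b \<otimes> (inv b \<otimes> x) \<in> generate G V"
      by (simp add: generate.eng generate.incl)
    then show "x \<in> generate G V" using b subgroup.mem_carrier[OF B b(1)] by (simp add: cancel_inv)
  qed
  moreover have "openin T (\<Union>b \<in> generate G V. coset V b)"
    by (intro openin_Union) (use openin_coset[OF V(1)] subgroup.mem_carrier[OF B] in auto)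
  ultimately show ?thesis by simp
qed

lemma finite_coset_cover:
  assumes "compact_space T" "openin T U" "U \<noteq> {}"
  obtains A where "finite A" "A \<subseteq> carrier G" "A \<noteq> {}" "carrier G \<subseteq> (\<Union>a \<in> A. coset U a)"
proof -
  obtain u where u: "u \<in> U" "u \<in> carrier G" using assms(2,3) openin_subset by fastforce
  have "topspace T \<subseteq> \<Union> (coset U ` carrier G)"
  proof
    fix x assume "x \<in> topspace T"
    then have x: "x \<in> carrier G" by simp
    then have "x \<in> coset U (x \<otimes> inv u)" using u by (simp add: coset_def word_simps)
    then show "x \<in> \<Union> (coset U ` carrier G)"
      using UnionI[OF imageI[OF m_closed[OF x inv_closed[OF u(2)]]]] by simp
  qed
  moreover have "\<And>W. W \<in> coset U ` carrier G \<Longrightarrow> openin T W" using openin_coset[OF assms(2)] by auto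
  ultimately obtain \<F> where F: "finite \<F>" "\<F> \<subseteq> coset U ` carrier G" "topspace T \<subseteq> \<Union>\<F>"
    using assms(1) unfolding compact_space_alt by (metis (no_types, lifting))
  then obtain A where A: "A \<subseteq> carrier G" "finite A" "\<F> = coset U ` A"
    using finite_subset_image by metis
  then have "carrier G \<subseteq> (\<Union>a \<in> A. coset U a)" using F(3) by simp
  moreover have "A \<noteq> {}" using calculation one_closed by auto
  ultimately show thesis using that A by blast
qed

text \<open>\<open>N\<close> is the normal core of the open subgroup \<open>B\<close> generated by
  \<open>V\<close>. By compactness finitely many cosets \<open>a B\<close> cover \<open>G\<close>,
  and conjugates of \<open>B\<close> depend only on the coset, so the core is a finite intersection
  of open sets.\<close>

lemma open_normal_subgroup:
  assumes "compact_space T" "openin T V" "\<one> \<in> V"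
  obtains N where "N \<lhd> G" "openin T N" "N \<subseteq> generate G V"
proof -
  define B where "B = generate G V"
  have Vsub: "V \<subseteq> carrier G" using openin_subset[OF assms(2)] by simp
  have B: "subgroup B G" unfolding B_def by (rule generate_is_subgroup[OF Vsub])
  have Bo: "openin T B" unfolding B_def by (rule openin_generate[OF assms(2,3)])
  have Bc: "b \<in> carrier G" if "b \<in> B" for b by (rule subgroup.mem_carrier[OF B that])
  define N where "N = {x \<in> carrier G. \<forall>g \<in> carrier G. g \<otimes> x \<otimes> inv g \<in> B}"
  obtain A where A: "finite A" "A \<subseteq> carrier G" "A \<noteq> {}" "carrier G \<subseteq> (\<Union>a \<in> A. coset B a)"
    using finite_coset_cover[OF assms(1) Bo] subgroup.one_closed[OF B] by blast
  have N_eq: "N = (\<Inter>a \<in> A. {x \<in> carrier G. inv a \<otimes> x \<otimes> a \<in> B})"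
  proof (intro equalityI subsetI)
    fix x assume x: "x \<in> N"
    have "inv a \<otimes> x \<otimes> a \<in> B" if "a \<in> A" for a
    proof -
      have a: "a \<in> carrier G" using A(2) that by blast
      then have "inv a \<otimes> x \<otimes> inv (inv a) \<in> B" using x unfolding N_def by blast
      then show ?thesis using a by simp
    qed
    then show "x \<in> (\<Inter>a \<in> A. {x \<in> carrier G. inv a \<otimes> x \<otimes> a \<in> B})"
      using x A(2) by (auto simp: N_def)
  next
    fix x assume x: "x \<in> (\<Inter>a \<in> A. {x \<in> carrier G. inv a \<otimes> x \<otimes> a \<in> B})"
    then have xc: "x \<in> carrier G" using A(3) by auto
    have "g \<otimes> x \<otimes> inv g \<in> B" if g: "g \<in> carrier G" for g
    proof -
      \<comment> \<open>The coset of \<open>inv g\<close> is the relevant one: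
        \<open>inv g = a \<otimes> b\<close> with \<open>b\<close> in \<open>B\<close>, so
        \<open>g \<otimes> x \<otimes> inv g\<close> is \<open>inv a \<otimes> x \<otimes> a\<close>
        conjugated inside \<open>B\<close>.\<close>
      obtain a where a: "a \<in> A" "inv g \<in> coset B a" using A(4) g by blast
      then have ac: "a \<in> carrier G" using A(2) by blast
      define b where "b = inv a \<otimes> inv g"
      have b: "b \<in> B" using a by (simp add: coset_def b_def)
      have bc: "b \<in> carrier G" by (rule Bc[OF b])
      have "inv a \<otimes> x \<otimes> a \<in> B" using x a(1) by blast
      then have "inv b \<otimes> (inv a \<otimes> x \<otimes> a) \<otimes> b \<in> B"
        using b subgroup.m_closed[OF B] subgroup.m_inv_closed[OF B] by simp
      moreover have "inv b \<otimes> (inv a \<otimes> x \<otimes> a) \<otimes> b = g \<otimes> x \<otimes> inv g"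
        using ac g xc by (simp add: b_def word_simps)
      ultimately show ?thesis by simp
    qed
    then show "x \<in> N" using xc by (simp add: N_def)
  qed
  have "openin T N"
    unfolding N_eq
    by (intro openin_INT2) (use A continuous_translate Bo in \<open>auto intro!: openin_preimage\<close>)
  moreover have "N \<subseteq> B"
  proof
    fix x assume "x \<in> N"
    then have "x \<in> carrier G" "\<one> \<otimes> x \<otimes> inv \<one> \<in> B" unfolding N_def by blast+
    then show "x \<in> B" by simp
  qed
  moreover have "N \<lhd> G"
  proof (rule normal_invI)
    show "subgroup N G"
    proof (rule subgroupI)
      show "N \<noteq> {}" using subgroup.one_closed[OF B] by (auto simp: N_def intro!: exI[of _ \<one>])
      fix a assume a: "a \<in> N"
      have "g \<otimes> inv a \<otimes> inv g \<in> B" if "g \<in> carrier G" for g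
      proof -
        have "inv (g \<otimes> a \<otimes> inv g) \<in> B"
          using a that by (intro subgroup.m_inv_closed[OF B]) (simp add: N_def)
        then show ?thesis using a that by (simp add: N_def word_simps)
      qed
      then show "inv a \<in> N" using a by (simp add: N_def)
      fix b assume b: "b \<in> N"
      have "g \<otimes> (a \<otimes> b) \<otimes> inv g \<in> B" if "g \<in> carrier G" for g
      proof -
        have "(g \<otimes> a \<otimes> inv g) \<otimes> (g \<otimes> b \<otimes> inv g) \<in> B"
          using a b that subgroup.m_closed[OF B] by (simp add: N_def)
        then show ?thesis using a b that by (simp add: N_def word_simps)
      qed
      then show "a \<otimes> b \<in> N" using a b by (simp add: N_def)
    qed (auto simp: N_def)
    fix h x assume h: "h \<in> carrier G" and x: "x \<in> N"
    have "g \<otimes> (h \<otimes> x \<otimes> inv h) \<otimes> inv g \<in> B" if "g \<in> carrier G" for g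
    proof -
      have "(g \<otimes> h) \<otimes> x \<otimes> inv (g \<otimes> h) \<in> B"
        using x h that by (simp add: N_def del: inv_mult_group)
      then show ?thesis using x h that by (simp add: N_def word_simps)
    qed
    then show "h \<otimes> x \<otimes> inv h \<in> N" using x h by (simp add: N_def)
  qed
  ultimately show thesis using that by (simp add: B_def)
qed

end

lemma (in polynomial_maps) finite_poly_image:
  assumes "topological_group G T" "Hausdorff_space T"
    and TX: "compact_space TX" "topspace TX = X" "X \<noteq> {}"
    and homeo: "\<And>\<sigma>. \<sigma> \<in> \<Sigma> \<Longrightarrow> homeomorphic_map TX TX \<sigma>"
    and trans: "\<And>x y. \<lbrakk>x \<in> X; y \<in> X\<rbrakk> \<Longrightarrow> \<exists>\<sigma> \<in> \<Sigma>. \<sigma> x = y"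
  shows "\<lbrakk>continuous_map TX T f; f ` X \<prec> (UNIV :: nat set set); poly_map m i f; finite (H (i + m))\<rbrakk>
    \<Longrightarrow> finite (f ` X)"
proof (induction m arbitrary: i f)
  case 0
  then have "f ` X \<subseteq> H i" by auto
  then show ?case using 0 finite_subset by auto
next
  case (Suc m)
  interpret group_topology G T by unfold_locales (rule assms(1))
  obtain V v where V: "openin TX V" "V \<noteq> {}" and v: "\<And>x. x \<in> V \<Longrightarrow> f x = v"
    using constant_on_open[OF TX(1) _ assms(2) Suc.prems(1)] TX Suc.prems(2) by metis
  have VX: "V \<subseteq> X" using openin_subset[OF V(1)] TX(2) by simp
  have diff: "finite (diff_map \<sigma> f ` X)" if s: "\<sigma> \<in> \<Sigma>" for \<sigma>
  proof (rule Suc.IH)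
    note cont = homeomorphic_imp_continuous_map[OF homeo[OF s]]
    have fs: "continuous_map TX T (\<lambda>x. f (\<sigma> x))"
      using continuous_map_compose[OF cont Suc.prems(1)] by (simp add: o_def)
    show "continuous_map TX T (diff_map \<sigma> f)"
      unfolding diff_map_def by (intro continuous_mult continuous_inv fs Suc.prems(1))
    have "(\<lambda>x. f (\<sigma> x)) ` X \<subseteq> f ` X" using shift_closed[OF s] by auto
    then have "(\<lambda>x. f (\<sigma> x)) ` X \<prec> (UNIV :: nat set set)"
      using Suc.prems(2) subset_imp_lepoll lesspoll_trans1 by blast
    then show "diff_map \<sigma> f ` X \<prec> (UNIV :: nat set set)"
      unfolding diff_map_def by (rule lesspoll_image2[OF Suc.prems(2)])
    show "poly_map m (Suc i) (diff_map \<sigma> f)" using Suc.prems(3) s by simp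
    show "finite (H (Suc i + m))" using Suc.prems(4) by simp
  qed
  obtain x0 where x0: "x0 \<in> V" using V(2) by blast
  have "X \<subseteq> \<Union> ((\<lambda>\<sigma>. \<sigma> ` V) ` \<Sigma>)"
  proof
    fix y assume "y \<in> X"
    then obtain \<sigma> where "\<sigma> \<in> \<Sigma>" "\<sigma> x0 = y" using trans VX x0 by blast
    then show "y \<in> \<Union> ((\<lambda>\<sigma>. \<sigma> ` V) ` \<Sigma>)" using x0 by blast
  qed
  moreover have "openin TX W" if "W \<in> (\<lambda>\<sigma>. \<sigma> ` V) ` \<Sigma>" for W
    using that homeo V(1) homeomorphic_imp_open_map unfolding open_map_def by blast
  ultimately obtain \<F> where F: "finite \<F>" "\<F> \<subseteq> (\<lambda>\<sigma>. \<sigma> ` V) ` \<Sigma>" "X \<subseteq> \<Union>\<F>"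
    using TX(1,2) unfolding compact_space_alt by (metis (no_types, lifting))
  then obtain A where A: "A \<subseteq> \<Sigma>" "finite A" "\<F> = (\<lambda>\<sigma>. \<sigma> ` V) ` A"
    using finite_subset_image by metis
  have "f ` X \<subseteq> (\<Union>\<sigma> \<in> A. (\<lambda>d. v \<otimes> d) ` diff_map \<sigma> f ` X)"
  proof
    fix z assume "z \<in> f ` X"
    then obtain y where y: "y \<in> X" "z = f y" by blast
    then obtain \<sigma> x where s: "\<sigma> \<in> A" "x \<in> V" "y = \<sigma> x" using F(3) A(3) by blast
    have "f x \<in> carrier G" "f y \<in> carrier G"
      using poly_map_closed[OF Suc.prems(3)] s(2) VX y(1) by auto
    then have "z = v \<otimes> diff_map \<sigma> f x"
      using s y v[OF s(2)] by (simp add: diff_map_def cancel_inv)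
    then show "z \<in> (\<Union>\<sigma> \<in> A. (\<lambda>d. v \<otimes> d) ` diff_map \<sigma> f ` X)" using s VX by blast
  qed
  moreover have "finite (\<Union>\<sigma> \<in> A. (\<lambda>d. v \<otimes> d) ` diff_map \<sigma> f ` X)"
    using A diff by blast
  ultimately show ?case by (rule finite_subset)
qed

section \<open>Nilpotent open subgroups from commutators with few values\<close>

primrec left_normed :: "('a, 'm) monoid_scheme \<Rightarrow> (nat \<Rightarrow> 'a) \<Rightarrow> nat \<Rightarrow> 'a"
  where
    "left_normed G g 0 = g 0"
  | "left_normed G g (Suc n) = gcomm G (left_normed G g n) (g (Suc n))"

lemma left_normed_cong:
  "(\<And>k. k \<le> n \<Longrightarrow> g k = h k) \<Longrightarrow> left_normed G g n = left_normed G h n"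
  by (induction n) auto

context group
begin

lemma left_normed_closed:
  "(\<And>k. k \<le> n \<Longrightarrow> g k \<in> carrier G) \<Longrightarrow> left_normed G g n \<in> carrier G"
  by (induction n) auto

text \<open>Extensional tuples are the points of the product topology, so the \<gamma>-values become
  the image of a compact space.\<close>

lemma gamma_values_eq: "gamma_values G n = (\<lambda>g. left_normed G g n) ` ({..n} \<rightarrow>\<^sub>E carrier G)"
proof (induction n)
  case 0
  show ?case
  proof (intro equalityI subsetI)
    fix x assume "x \<in> gamma_values G 0"
    then show "x \<in> (\<lambda>g. left_normed G g 0) ` ({..0} \<rightarrow>\<^sub>E carrier G)"
      by (intro image_eqI[of _ _ "restrict (\<lambda>_. x) {..0}"]) auto
  qed auto
next
  case (Suc n)
  show ?case
  proof (intro equalityI subsetI)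
    fix x assume "x \<in> gamma_values G (Suc n)"
    then obtain g y where g: "g \<in> {..n} \<rightarrow>\<^sub>E carrier G" "y \<in> carrier G"
      "x = gcomm G (left_normed G g n) y"
      using Suc by auto
    have "left_normed G (g(Suc n := y)) n = left_normed G g n"
      by (rule left_normed_cong) auto
    then have "x = left_normed G (g(Suc n := y)) (Suc n)" using g by simp
    moreover have "g(Suc n := y) \<in> {..Suc n} \<rightarrow>\<^sub>E carrier G"
      using g by (auto simp: PiE_iff extensional_def le_Suc_eq)
    ultimately show "x \<in> (\<lambda>g. left_normed G g (Suc n)) ` ({..Suc n} \<rightarrow>\<^sub>E carrier G)" by blast
  next
    fix x assume "x \<in> (\<lambda>g. left_normed G g (Suc n)) ` ({..Suc n} \<rightarrow>\<^sub>E carrier G)"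
    then obtain g where g: "g \<in> {..Suc n} \<rightarrow>\<^sub>E carrier G" "x = left_normed G g (Suc n)" by blast
    have "left_normed G g n = left_normed G (restrict g {..n}) n"
      by (rule left_normed_cong) auto
    moreover have "restrict g {..n} \<in> {..n} \<rightarrow>\<^sub>E carrier G" using g by (auto simp: PiE_iff)
    ultimately have "left_normed G g n \<in> gamma_values G n" using Suc by auto
    then show "x \<in> gamma_values G (Suc n)" using g by auto
  qed
qed

text \<open>For normal \<open>L\<close> the elements \<open>y\<close> with \<open>[u,y]\<close> in \<open>L\<close> form a subgroup, so \<open>N\<close> consists of such
  elements as soon as \<open>W\<close> does; the entries of the commutator are peeled off from the right.\<close>

lemma left_normed_rel_upper_central:
  assumes N: "N \<lhd> G"
    and W: "\<And>k. W k \<subseteq> carrier G" "\<And>k. W k \<noteq> {}"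
    and NW: "\<And>k. k \<le> n \<Longrightarrow> N \<subseteq> generate G (W k)"
  shows "\<lbrakk>i \<le> n; \<And>g. (\<And>k. k \<le> i \<Longrightarrow> g k \<in> W k) \<Longrightarrow> left_normed G g i \<in> rel_upper_central G {\<one>} N j\<rbrakk>
    \<Longrightarrow> N \<subseteq> rel_upper_central G {\<one>} N (i + j)"
proof (induction i arbitrary: j)
  case 0
  have "W 0 \<subseteq> rel_upper_central G {\<one>} N j"
  proof
    fix x assume "x \<in> W 0"
    then show "x \<in> rel_upper_central G {\<one>} N j" using 0(2)[of "\<lambda>_. x"] by simp
  qed
  then have "generate G (W 0) \<subseteq> rel_upper_central G {\<one>} N j"
    by (rule generate_subgroup_incl[OF _ normal_imp_subgroup[OF
            normal_rel_upper_central[OF one_is_normal N]]])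
  then show ?case using NW[of 0] 0(1) by simp
next
  case (Suc i)
  have "N \<subseteq> rel_upper_central G {\<one>} N (i + Suc j)"
  proof (rule Suc.IH)
    show "i \<le> n" using Suc.prems(1) by simp
    fix g assume g: "\<And>k. k \<le> i \<Longrightarrow> g k \<in> W k"
    define u where "u = left_normed G g i"
    have u: "u \<in> carrier G" unfolding u_def using g W(1) by (intro left_normed_closed) blast
    have step: "gcomm G u y \<in> rel_upper_central G {\<one>} N j" if y: "y \<in> W (Suc i)" for y
    proof -
      have "left_normed G (g(Suc i := y)) i = u"
        unfolding u_def by (rule left_normed_cong) auto
      then have "gcomm G u y = left_normed G (g(Suc i := y)) (Suc i)" by simp
      also have "\<dots> \<in> rel_upper_central G {\<one>} N j"
        using g y by (intro Suc.prems(2)) (auto simp: le_Suc_eq)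
      finally show ?thesis .
    qed
    have "gcomm G u y \<in> rel_upper_central G {\<one>} N j" if "y \<in> N" for y
    proof (rule gcomm_generate_right[OF normal_rel_upper_central[OF one_is_normal N] W(1) u step])
      show "y \<in> generate G (W (Suc i))" using NW[OF Suc.prems(1)] that by blast
    qed
    then show "left_normed G g i \<in> rel_upper_central G {\<one>} N (Suc j)"
      using u by (simp add: u_def)
  qed
  then show ?case by simp
qed

end

context group_topology
begin

lemma continuous_left_normed:
  "\<lbrakk>\<And>k. k \<le> n \<Longrightarrow> continuous_map X T (\<lambda>x. g x k)\<rbrakk> \<Longrightarrow> continuous_map X T (\<lambda>x. left_normed G (g x) n)"
  by (induction n) (auto intro: continuous_gcomm)

text \<open>On a box where the commutator is constant, \<open>[u, y] = [u, y']\<close> forces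
  \<open>u\<close> to commute with \<open>inv y' \<otimes> y\<close>. Such quotients generate a
  subgroup containing \<open>N\<close>, so \<open>u\<close> centralizes \<open>N\<close>; the
  remaining entries are then handled by \<open>left_normed_rel_upper_central\<close>.\<close>

lemma nilpotent_open_normal_subgroup:
  assumes "compact_space T" "Hausdorff_space T"
    and small: "gamma_values G (Suc n) \<prec> (UNIV :: nat set set)"
  obtains N where "N \<lhd> G" "openin T N" "N \<subseteq> rel_upper_central G {\<one>} N (Suc n)"
proof -
  let ?P = "product_topology (\<lambda>_. T) {..Suc n}"
  let ?f = "\<lambda>g. left_normed G g (Suc n)"
  have topP: "topspace ?P = {..Suc n} \<rightarrow>\<^sub>E carrier G" by simp
  have compP: "compact_space ?P" using assms(1) by (simp add: compact_space_product_topology)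
  have "(\<lambda>_ \<in> {..Suc n}. \<one>) \<in> topspace ?P" unfolding topP by auto
  then have ne: "topspace ?P \<noteq> {}" by blast
  have contf: "continuous_map ?P T ?f"
    by (rule continuous_left_normed) (auto intro: continuous_map_product_projection)
  have smallf: "?f ` topspace ?P \<prec> (UNIV :: nat set set)"
    using small unfolding topP gamma_values_eq[symmetric] .
  have "\<exists>U v. openin ?P U \<and> U \<noteq> {} \<and> (\<forall>g \<in> U. ?f g = v)"
    by (rule constant_on_open[OF compP ne assms(2) contf smallf]) blast
  then obtain U v where U: "openin ?P U" "U \<noteq> {}" and v: "\<And>g. g \<in> U \<Longrightarrow> ?f g = v"
    by blast
  obtain x where x: "x \<in> U" using U(2) by blast
  obtain W where W: "x \<in> Pi\<^sub>E {..Suc n} W" "\<And>i. openin T (W i)" "Pi\<^sub>E {..Suc n} W \<subseteq> U"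
    using product_topology_open_contains_basis[OF U(1) x] by blast
  have Wc: "W i \<subseteq> carrier G" for i using openin_subset[OF W(2)] by simp
  have xW: "x i \<in> W i" if "i \<le> Suc n" for i using W(1) that by auto
  \<comment> \<open>Translating every factor of the box to \<open>\<one>\<close> and intersecting
    yields one neighbourhood that serves all entries at once.\<close>
  define V where "V = (\<Inter>i \<in> {..Suc n}. {z \<in> carrier G. x i \<otimes> z \<in> W i})"
  have xc: "x i \<in> carrier G" if "i \<le> Suc n" for i using xW[OF that] Wc by blast
  have "openin T V"
    unfolding V_def by (intro openin_INT2 openin_preimage continuous_left) (auto simp: W(2) intro: xc)
  moreover have "\<one> \<in> V" using xW xc by (auto simp: V_def)
  ultimately obtain N where N: "N \<lhd> G" "openin T N" "N \<subseteq> generate G V"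
    using open_normal_subgroup[OF assms(1)] by blast
  \<comment> \<open>Truncation by \<open>min\<close>: the factors \<open>W k\<close> are known to be
    nonempty only for \<open>k \<le> Suc n\<close>, but \<open>left_normed_rel_upper_central\<close>
    wants a family indexed by all \<open>k\<close>.\<close>
  define D where "D k = {inv y' \<otimes> y | y y'. y \<in> W (min k (Suc n)) \<and> y' \<in> W (min k (Suc n))}" for k
  have Dc: "D k \<subseteq> carrier G" for k using Wc by (fastforce simp: D_def)
  have VD: "V \<subseteq> D k" if "k \<le> Suc n" for k
  proof
    fix z assume z: "z \<in> V"
    then have "x k \<otimes> z \<in> W k" "z \<in> carrier G" using that by (auto simp: V_def)
    moreover have "z = inv (x k) \<otimes> (x k \<otimes> z)" using \<open>z \<in> carrier G\<close> xc[OF that] by (simp add: cancel_inv)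
    ultimately show "z \<in> D k" using xW[OF that] that unfolding D_def min_absorb1[OF that] by blast
  qed
  have ND: "N \<subseteq> generate G (D k)" if "k \<le> Suc n" for k
    using N(3) mono_generate[OF VD[OF that]] by blast
  have NW: "N \<subseteq> generate G (W (min k (Suc n)))" if "k \<le> n" for k
  proof -
    have sg: "subgroup (generate G (W (min k (Suc n)))) G" by (rule generate_is_subgroup[OF Wc])
    have "D k \<subseteq> generate G (W (min k (Suc n)))"
      unfolding D_def
      by (auto intro!: subgroup.m_closed[OF sg] subgroup.m_inv_closed[OF sg] intro: generate.incl)
    then have "generate G (D k) \<subseteq> generate G (W (min k (Suc n)))"
      by (rule generate_subgroup_incl[OF _ sg])
    then show ?thesis using ND[of k] that by auto
  qed
  have commute: "left_normed G g n \<in> rel_upper_central G {\<one>} N 1"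
    if g: "\<And>k. k \<le> n \<Longrightarrow> g k \<in> W (min k (Suc n))" for g
  proof -
    define u where "u = left_normed G g n"
    have gW: "g k \<in> W k" if "k \<le> n" for k using g[OF that] that by (simp add: min_absorb1)
    have u: "u \<in> carrier G" unfolding u_def using gW Wc by (intro left_normed_closed) blast
    have val: "gcomm G u y = v" if y: "y \<in> W (Suc n)" for y
    proof -
      define h where "h = restrict (g(Suc n := y)) {..Suc n}"
      have "left_normed G h n = u" unfolding u_def h_def by (rule left_normed_cong) auto
      moreover have "h (Suc n) = y" by (simp add: h_def)
      ultimately have "?f h = gcomm G u y" by simp
      moreover have "h \<in> Pi\<^sub>E {..Suc n} W" using gW y by (auto simp: h_def le_Suc_eq)
      ultimately show ?thesis using v W(3) by auto
    qed
    have "gcomm G u d \<in> {\<one>}" if "d \<in> D (Suc n)" for d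
    proof -
      obtain y y' where d: "d = inv y' \<otimes> y" "y \<in> W (Suc n)" "y' \<in> W (Suc n)"
        using \<open>d \<in> D (Suc n)\<close> by (auto simp: D_def)
      then have c: "y \<in> carrier G" "y' \<in> carrier G" using Wc by auto
      have "gcomm G u y = gcomm G u y'" using val d by simp
      moreover have "gcomm G u d = u \<otimes> inv y' \<otimes> inv u \<otimes> gcomm G u y \<otimes> y' "
        using u c by (simp add: d(1) word_simps)
      moreover have "u \<otimes> inv y' \<otimes> inv u \<otimes> gcomm G u y' \<otimes> y' = \<one>"
        using u c by (simp add: word_simps)
      ultimately show ?thesis by simp
    qed
    then have "gcomm G u y \<in> {\<one>}" if "y \<in> N" for y
      using gcomm_generate_right[OF one_is_normal Dc u, of "Suc n" y] ND[of "Suc n"] that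
      by blast
    then show ?thesis using u by (simp add: u_def)
  qed
  have "W (min k (Suc n)) \<noteq> {}" for k
    using xW[of "min k (Suc n)"] by auto
  then have "N \<subseteq> rel_upper_central G {\<one>} N (n + 1)"
    by (rule left_normed_rel_upper_central[OF N(1) Wc _ NW order_refl commute])
  then show thesis using that N by simp
qed

section \<open>Polynomial maps on boxes of cosets\<close>

definition coset_box :: "'i set \<Rightarrow> 'a set \<Rightarrow> ('i \<Rightarrow> 'a) \<Rightarrow> ('i \<Rightarrow> 'a) set"
  where "coset_box I N t = (\<Pi>\<^sub>E i \<in> I. coset N (t i))"

text \<open>Right multiplication by \<open>N\<close> preserves left cosets and makes the difference
  of a coordinate constant; the restriction to \<open>I\<close> keeps points extensional.\<close>

definition box_shift :: "'i set \<Rightarrow> ('i \<Rightarrow> 'a) \<Rightarrow> ('i \<Rightarrow> 'a) \<Rightarrow> 'i \<Rightarrow> 'a"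
  where "box_shift I h x = (\<lambda>i \<in> I. x i \<otimes> h i)"

end

locale open_normal_nilpotent = group_topology +
  fixes N :: "'a set" and c :: nat and I :: "'i set"
  assumes compact_T: "compact_space T" and Hausdorff_T: "Hausdorff_space T"
    and normal_N: "N \<lhd> G" and open_N: "openin T N"
    and nilpotent_N: "rel_lower_central G N c = {\<one>}"
    and finite_I: "finite I"
begin

abbreviation "shifts \<equiv> box_shift I ` (I \<rightarrow> N)"

sublocale fil: group_filtration G "rel_lower_central G N"
  by (rule group_filtration_rel_lower_central[OF normal_N])

lemma N_subgroup: "subgroup N G"
  by (rule normal_imp_subgroup[OF normal_N])

lemma N_carrier: "x \<in> N \<Longrightarrow> x \<in> carrier G"
  by (rule subgroup.mem_carrier[OF N_subgroup])

lemma coset_mult: "\<lbrakk>x \<in> coset N t; h \<in> N; t \<in> carrier G\<rbrakk> \<Longrightarrow> x \<otimes> h \<in> coset N t"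
  using subgroup.m_closed[OF N_subgroup, of "inv t \<otimes> x" h] N_carrier[of h]
  by (auto simp: coset_def m_assoc)

lemma coset_box_closed:
  assumes "t \<in> I \<rightarrow> carrier G" "h \<in> I \<rightarrow> N" "x \<in> coset_box I N t"
  shows "box_shift I h x \<in> coset_box I N t"
  using assms by (auto simp: coset_box_def box_shift_def PiE_iff intro!: coset_mult)

lemma polynomial_maps_box:
  "t \<in> I \<rightarrow> carrier G \<Longrightarrow> polynomial_maps G (rel_lower_central G N) (coset_box I N t) shifts"
  by (intro polynomial_maps.intro fil.group_filtration_axioms polynomial_maps_axioms.intro)
    (auto intro: coset_box_closed)

text \<open>The difference of a coordinate along \<open>h\<close> is the constant \<open>h i\<close>
  in \<open>N\<close>, the term of index \<open>1\<close>, and further differences are trivial;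
  hence any \<open>m\<close> is allowed.\<close>

lemma poly_map_coordinate:
  assumes t: "t \<in> I \<rightarrow> carrier G" and i: "i \<in> I"
  shows "polynomial_maps.poly_map G (rel_lower_central G N) (coset_box I N t) shifts m 0 (\<lambda>x. x i)"
proof -
  interpret polynomial_maps G "rel_lower_central G N" "coset_box I N t" shifts
    by (rule polynomial_maps_box[OF t])
  have xc: "x i \<in> carrier G" if "x \<in> coset_box I N t" for x
    using that i by (auto simp: coset_box_def coset_def)
  show ?thesis
  proof (cases m)
    case (Suc k)
    have "poly_map k (Suc 0) (diff_map \<sigma> (\<lambda>x. x i))" if s: "\<sigma> \<in> shifts" for \<sigma>
    proof -
      obtain h where h: "h \<in> I \<rightarrow> N" "\<sigma> = box_shift I h" using s by blast
      have "h i \<in> N" using h i by auto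
      then have "poly_map k (Suc 0) (\<lambda>_. h i)" by (intro poly_map_const) simp
      then show ?thesis
        by (rule poly_map_cong)
          (use xc N_carrier[OF \<open>h i \<in> N\<close>] i in \<open>auto simp: diff_map_def h(2) box_shift_def cancel_inv\<close>)
    qed
    then show ?thesis using Suc xc by simp
  qed (use xc in simp)
qed

lemma homeomorphic_shift:
  assumes t: "t \<in> I \<rightarrow> carrier G" and h: "h \<in> I \<rightarrow> N"
  defines "TX \<equiv> subtopology (product_topology (\<lambda>_. T) I) (coset_box I N t)"
  shows "homeomorphic_map TX TX (box_shift I h)"
proof -
  have sub: "coset_box I N t \<subseteq> I \<rightarrow>\<^sub>E carrier G"
    by (auto simp: coset_box_def coset_def PiE_iff)
  then have topX: "topspace TX = coset_box I N t" by (auto simp: TX_def)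
  have cont: "continuous_map TX TX (box_shift I k)" if k: "k \<in> I \<rightarrow> N" for k
  proof -
    have "continuous_map TX (product_topology (\<lambda>_. T) I) (box_shift I k)"
      unfolding continuous_map_componentwise
    proof (intro conjI ballI)
      show "box_shift I k ` topspace TX \<subseteq> extensional I" by (auto simp: box_shift_def)
      fix i assume i: "i \<in> I"
      have "continuous_map TX T (\<lambda>x. x i \<otimes> k i)"
        unfolding TX_def
        using N_carrier k i
        by (intro continuous_mult continuous_map_from_subtopology continuous_map_product_projection
            continuous_const) auto
      then show "continuous_map TX T (\<lambda>x. box_shift I k x i)"
        using i by (simp add: box_shift_def)
    qed
    then show ?thesis
      unfolding TX_def using coset_box_closed[OF t k] topX
      by (intro continuous_map_into_subtopology) (auto simp: TX_def)
  qed
  define h' where "h' = (\<lambda>i. inv (h i))"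
  have h': "h' \<in> I \<rightarrow> N" using h subgroup.m_inv_closed[OF N_subgroup] by (auto simp: h'_def)
  have "box_shift I h' (box_shift I h x) = x \<and> box_shift I h (box_shift I h' x) = x"
    if x: "x \<in> coset_box I N t" for x
  proof -
    have e: "x \<in> extensional I" "\<And>i. i \<in> I \<Longrightarrow> x i \<in> carrier G" using x sub by (auto simp: PiE_iff)
    have "h i \<in> carrier G" if "i \<in> I" for i using h that N_carrier by auto
    then show ?thesis
      using e by (auto simp: box_shift_def h'_def m_assoc fun_eq_iff extensional_def)
  qed
  then have "homeomorphic_maps TX TX (box_shift I h) (box_shift I h')"
    unfolding homeomorphic_maps_def using cont[OF h] cont[OF h'] topX by simp
  then show ?thesis by (rule homeomorphic_maps_map[THEN iffD1, THEN conjunct1])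
qed

text \<open>The shifts by \<open>N\<close> do not move points between boxes but act transitively on
  each, so \<open>finite_poly_image\<close> is applied box by box. After \<open>c\<close>
  differences the filtration is trivial, which is its finiteness condition.\<close>

theorem finite_polynomial_values:
  assumes cont: "continuous_map (product_topology (\<lambda>_. T) I) T f"
    and small: "f ` (I \<rightarrow>\<^sub>E carrier G) \<prec> (UNIV :: nat set set)"
    and poly: "\<And>t. t \<in> I \<rightarrow> carrier G \<Longrightarrow>
      polynomial_maps.poly_map G (rel_lower_central G N) (coset_box I N t) shifts c 0 f"
  shows "finite (f ` (I \<rightarrow>\<^sub>E carrier G))"
proof -
  have N1: "\<one> \<in> N" by (rule subgroup.one_closed[OF N_subgroup])
  have closed_N: "closedin T N" by (rule closedin_open_subgroup[OF N_subgroup open_N])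
  have fin: "finite (f ` coset_box I N t)" if t: "t \<in> I \<rightarrow> carrier G" for t
  proof -
    interpret polynomial_maps G "rel_lower_central G N" "coset_box I N t" shifts
      by (rule polynomial_maps_box[OF t])
    define TX where "TX = subtopology (product_topology (\<lambda>_. T) I) (coset_box I N t)"
    have sub: "coset_box I N t \<subseteq> I \<rightarrow>\<^sub>E carrier G"
      by (auto simp: coset_box_def coset_def PiE_iff)
    have tN: "t i \<in> coset N (t i)" if "i \<in> I" for i
      using l_inv[OF funcset_mem[OF t that]] funcset_mem[OF t that] N1 by (simp add: coset_def)
    show ?thesis
    proof (rule finite_poly_image[where TX = TX and m = c and i = 0])
      show "topological_group G T" by (rule topological)
      show "Hausdorff_space T" by (rule Hausdorff_T)
      have "compactin T (coset N (t i))" if "i \<in> I" for i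
        using closedin_compact_space[OF compact_T closedin_coset[OF closed_N]] t that by auto
      then have "compactin (product_topology (\<lambda>_. T) I) (coset_box I N t)"
        unfolding coset_box_def compactin_PiE by blast
      then show "compact_space TX" unfolding TX_def by (rule compact_space_subtopology)
      show "topspace TX = coset_box I N t" using sub by (auto simp: TX_def)
      have "restrict t I \<in> coset_box I N t" using tN by (auto simp: coset_box_def)
      then show "coset_box I N t \<noteq> {}" by blast
      show "homeomorphic_map TX TX \<sigma>" if "\<sigma> \<in> shifts" for \<sigma>
        using homeomorphic_shift[OF t] that by (auto simp: TX_def)
      show "\<exists>\<sigma> \<in> shifts. \<sigma> x = y" if x: "x \<in> coset_box I N t" and y: "y \<in> coset_box I N t" for x y
      proof -
        \<comment> \<open>Both \<open>x i\<close> and \<open>y i\<close> lie in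
          \<open>t i N\<close>, so the quotient lies in \<open>N\<close> and shifting by it takes
          \<open>x\<close> to \<open>y\<close>.\<close>
        define h where "h = (\<lambda>i. inv (x i) \<otimes> y i)"
        have xy: "x i \<in> carrier G" "inv (t i) \<otimes> x i \<in> N" "y i \<in> carrier G" "inv (t i) \<otimes> y i \<in> N"
          if "i \<in> I" for i
          using x y that by (auto simp: coset_box_def coset_def)
        have "h i \<in> N" if i: "i \<in> I" for i
        proof -
          have "inv (inv (t i) \<otimes> x i) \<otimes> (inv (t i) \<otimes> y i) \<in> N"
            by (intro subgroup.m_closed[OF N_subgroup] subgroup.m_inv_closed[OF N_subgroup] xy i)
          moreover have "t i \<in> carrier G" using t i by auto
          ultimately show ?thesis using xy[OF i] by (simp add: h_def word_simps)
        qed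
        moreover have "box_shift I h x = y"
          using xy y by (auto simp: box_shift_def h_def cancel_inv fun_eq_iff coset_box_def PiE_iff extensional_def)
        ultimately show ?thesis by blast
      qed
      show "continuous_map TX T f" unfolding TX_def by (rule continuous_map_from_subtopology[OF cont])
      have "f ` coset_box I N t \<subseteq> f ` (I \<rightarrow>\<^sub>E carrier G)" using sub by blast
      then show "f ` coset_box I N t \<prec> (UNIV :: nat set set)"
        using small subset_imp_lepoll lesspoll_trans1 by blast
      show "poly_map c 0 f" by (rule poly[OF t])
      show "finite (rel_lower_central G N (0 + c))" by (simp add: nilpotent_N)
    qed
  qed
  have "N \<noteq> {}" using N1 by blast
  then have "\<exists>A. finite A \<and> A \<subseteq> carrier G \<and> carrier G \<subseteq> (\<Union>a \<in> A. coset N a)"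
    by (rule finite_coset_cover[OF compact_T open_N]) blast
  then obtain A where A: "finite A" "A \<subseteq> carrier G" "carrier G \<subseteq> (\<Union>a \<in> A. coset N a)"
    by blast
  have "f ` (I \<rightarrow>\<^sub>E carrier G) \<subseteq> (\<Union>t \<in> I \<rightarrow>\<^sub>E A. f ` coset_box I N t)"
  proof
    fix z assume "z \<in> f ` (I \<rightarrow>\<^sub>E carrier G)"
    then obtain x where x: "x \<in> I \<rightarrow>\<^sub>E carrier G" "z = f x" by blast
    have "\<forall>i \<in> I. \<exists>a \<in> A. x i \<in> coset N a" using x(1) A(3) by blast
    then obtain t where t: "\<And>i. i \<in> I \<Longrightarrow> t i \<in> A \<and> x i \<in> coset N (t i)" by metis
    then have "restrict t I \<in> I \<rightarrow>\<^sub>E A" "x \<in> coset_box I N (restrict t I)"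
      using x(1) by (auto simp: coset_box_def PiE_iff)
    then show "z \<in> (\<Union>t \<in> I \<rightarrow>\<^sub>E A. f ` coset_box I N t)" using x(2) by blast
  qed
  moreover have "finite (\<Union>t \<in> I \<rightarrow>\<^sub>E A. f ` coset_box I N t)"
    using A fin finite_PiE[OF finite_I] by (intro finite_UN_I) (auto simp: PiE_iff subset_iff Pi_def)
  ultimately show ?thesis by (rule finite_subset)
qed

end

section \<open>Verbal subgroups\<close>

lemma (in polynomial_maps) poly_map_left_normed:
  "(\<And>k. k \<le> n \<Longrightarrow> poly_map m 0 (\<lambda>x. g x k)) \<Longrightarrow> poly_map m 0 (\<lambda>x. left_normed G (g x) n)"
proof (induction n)
  case (Suc n)
  then have "poly_map m (0 + 0) (\<lambda>x. gcomm G (left_normed G (g x) n) (g x (Suc n)))"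
    using poly_map_group[of m] by (metis le_Suc_eq le_refl)
  then show ?case by simp
qed simp

lemma word_eval_cong:
  "(\<And>i. i \<in> fst ` set w \<Longrightarrow> g i = h i) \<Longrightarrow> word_eval G g w = word_eval G h w"
  by (induction w) (auto simp: word_eval_def split: prod.splits)

context group_hom
begin

lemma hom_word_eval:
  "(\<And>i. i \<in> fst ` set w \<Longrightarrow> g i \<in> carrier G) \<Longrightarrow>
    h (word_eval G g w) = word_eval H (\<lambda>i. h (g i)) w"
proof (induction w)
  case (Cons a w)
  have "word_eval G g w \<in> carrier G" using Cons.prems by (intro G.word_eval_closed) auto
  then show ?case using Cons by (auto simp: word_eval_def case_prod_beta)
qed (simp add: word_eval_def)

lemma hom_gcomm: "\<lbrakk>x \<in> carrier G; y \<in> carrier G\<rbrakk> \<Longrightarrow> h (gcomm G x y) = gcomm H (h x) (h y)"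
  by (simp add: gcomm_def)

lemma hom_left_normed:
  "(\<And>k. g k \<in> carrier G) \<Longrightarrow> h (left_normed G g n) = left_normed H (\<lambda>k. h (g k)) n"
  by (induction n) (auto simp: hom_gcomm G.left_normed_closed)

end

context group
begin

lemma word_values_subset: "fst ` set w \<subseteq> {1..r} \<Longrightarrow> word_values G r w \<subseteq> carrier G"
  by (auto simp: word_values_def intro!: word_eval_closed)

lemma word_values_eq:
  assumes "fst ` set w \<subseteq> {1..r}"
  shows "word_values G r w = (\<lambda>g. word_eval G g w) ` ({1..r} \<rightarrow>\<^sub>E carrier G)"
proof (intro equalityI subsetI)
  fix x assume "x \<in> word_values G r w"
  then obtain g where g: "g \<in> {1..r} \<rightarrow> carrier G" "x = word_eval G g w"
    by (auto simp: word_values_def)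
  then have "x = word_eval G (restrict g {1..r}) w"
    using assms by (auto intro!: word_eval_cong)
  then show "x \<in> (\<lambda>g. word_eval G g w) ` ({1..r} \<rightarrow>\<^sub>E carrier G)" using g(1) by auto
qed (auto simp: word_values_def PiE_iff)

lemma conj_closed_word_values:
  assumes w: "fst ` set w \<subseteq> {1..r}"
  shows "conj_closed (word_values G r w)"
  unfolding conj_closed_def
proof (intro conjI ballI)
  fix a x assume a: "a \<in> carrier G" and "x \<in> word_values G r w"
  then obtain g where g: "g \<in> {1..r} \<rightarrow> carrier G" "x = word_eval G g w"
    by (auto simp: word_values_def)
  interpret conj: group_hom G G "\<lambda>x. a \<otimes> x \<otimes> inv a"
    by unfold_locales (use a in \<open>auto simp: hom_def word_simps\<close>)
  have "a \<otimes> x \<otimes> inv a = word_eval G (\<lambda>i. a \<otimes> g i \<otimes> inv a) w"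
    unfolding g(2) using g(1) w by (intro conj.hom_word_eval) auto
  moreover have "(\<lambda>i. a \<otimes> g i \<otimes> inv a) \<in> {1..r} \<rightarrow> carrier G" using g(1) a by auto
  ultimately show "a \<otimes> x \<otimes> inv a \<in> word_values G r w" unfolding word_values_def by blast
qed (use word_values_subset[OF w] in blast)

lemma normal_verbal_subgroup:
  "fst ` set w \<subseteq> {1..r} \<Longrightarrow> verbal_subgroup G r w \<lhd> G"
  unfolding verbal_subgroup_def
  by (rule normal_generateI[OF word_values_subset conj_closedD(2)[OF conj_closed_word_values]])

lemma left_normed_lower_central:
  "(\<And>k. g k \<in> carrier G) \<Longrightarrow> left_normed G g n \<in> lower_central G n"
proof (induction n)
  case (Suc n)
  then show ?case by (auto simp: gcomm_def intro!: generate.incl)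
qed simp

text \<open>Permits raising the class by one, so that \<gamma> has at least two entries even if the
  quotient is trivial; the arguments that vary the last entry require this.\<close>

lemma lower_central_Suc_trivial:
  assumes "lower_central G n = {\<one>}"
  shows "lower_central G (Suc n) = {\<one>}"
proof -
  have "x \<otimes> y \<otimes> inv x \<otimes> inv y = \<one>" if "x = \<one>" "y \<in> carrier G" for x y
    using that by simp
  then have "generate G {x \<otimes> y \<otimes> inv x \<otimes> inv y | x y. x \<in> {\<one>} \<and> y \<in> carrier G} \<subseteq> {\<one>}"
    by (intro generate_subgroup_incl[OF _ triv_subgroup]) auto
  then show ?thesis using generate.one by (auto simp: assms)
qed

lemma left_normed_verbal:
  assumes w: "fst ` set w \<subseteq> {1..r}"
    and nil: "lower_central (G Mod verbal_subgroup G r w) n = {\<one>\<^bsub>G Mod verbal_subgroup G r w\<^esub>}"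
    and g: "\<And>k. g k \<in> carrier G"
  shows "left_normed G g n \<in> verbal_subgroup G r w"
proof -
  define V where "V = verbal_subgroup G r w"
  interpret V: normal V G unfolding V_def by (rule normal_verbal_subgroup[OF w])
  define Q where "Q = G Mod V"
  interpret Q: group Q unfolding Q_def by (rule V.factorgroup_is_group)
  interpret \<pi>: group_hom G Q "\<lambda>a. V #> a"
    by unfold_locales (unfold Q_def, rule V.r_coset_hom_Mod)
  have "V #> left_normed G g n \<in> lower_central Q n"
    using \<pi>.hom_left_normed[of g n, OF g] Q.left_normed_lower_central[of "\<lambda>k. V #> g k" n] \<pi>.hom_closed g
    by simp
  then have "V #> left_normed G g n = V"
    using nil by (simp add: Q_def FactGroup_def flip: V_def)
  moreover have "left_normed G g n \<in> carrier G" using g by (rule left_normed_closed)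
  ultimately show ?thesis
    using rcos_self[OF _ V.subgroup_axioms] V_def by blast
qed

text \<open>Here \<open>x\<close> is fixed and the homomorphism varies. Each factor of
  \<open>x\<close> is a word value or the inverse of one, homomorphisms send word values to word
  values, and smallness survives products and inverses.\<close>

lemma verbal_images_small:
  fixes F :: "('f, 'k) monoid_scheme"
  assumes F: "group F" and \<theta>: "\<And>g. g \<in> A \<Longrightarrow> \<theta> g \<in> hom F G"
    and w: "fst ` set w \<subseteq> {1..r}"
    and small: "word_values G r w \<prec> (UNIV :: nat set set)"
    and x: "x \<in> verbal_subgroup F r w"
  shows "(\<lambda>g. \<theta> g x) ` A \<prec> (UNIV :: nat set set)"
proof -
  interpret F: group F by (rule F)
  have gh: "group_hom F G (\<theta> g)" if "g \<in> A" for g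
    by (intro group_hom.intro group_hom_axioms.intro F is_group \<theta>[OF that])
  have small_values: "(\<lambda>g. \<theta> g x) ` A \<prec> (UNIV :: nat set set)" if "x \<in> word_values F r w" for x
  proof -
    obtain t where t: "t \<in> {1..r} \<rightarrow> carrier F" "x = word_eval F t w"
      using \<open>x \<in> word_values F r w\<close> by (auto simp: word_values_def)
    have "\<theta> g x \<in> word_values G r w" if g: "g \<in> A" for g
    proof -
      interpret group_hom F G "\<theta> g" by (rule gh[OF g])
      have "\<theta> g x = word_eval G (\<lambda>i. \<theta> g (t i)) w"
        unfolding t(2) using t(1) w by (intro hom_word_eval) auto
      moreover have "(\<lambda>i. \<theta> g (t i)) \<in> {1..r} \<rightarrow> carrier G"
        using hom_closed funcset_mem[OF t(1)] by blast
      ultimately show ?thesis unfolding word_values_def by blast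
    qed
    then have "(\<lambda>g. \<theta> g x) ` A \<subseteq> word_values G r w" by blast
    then show ?thesis using small subset_imp_lepoll lesspoll_trans1 by blast
  qed
  note sub = F.word_values_subset[OF w]
  show ?thesis
    using x unfolding verbal_subgroup_def
  proof induction
    case one
    have "(\<lambda>g. \<theta> g \<one>\<^bsub>F\<^esub>) ` A \<subseteq> {\<one>\<^bsub>G\<^esub>}" using group_hom.hom_one[OF gh] by auto
    then show ?case
      using finite_lesspoll_infinite[OF infinite_nat_sets] finite_subset by blast
  next
    case (incl x)
    then show ?case by (rule small_values)
  next
    case (inv x)
    then have "x \<in> carrier F" using sub by blast
    then have "(\<lambda>g. \<theta> g (inv\<^bsub>F\<^esub> x)) ` A = (\<lambda>g. inv\<^bsub>G\<^esub> (\<theta> g x)) ` A"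
      using group_hom.hom_inv[OF gh] by (intro image_cong) auto
    then show ?case
      using lesspoll_trans1[OF image_lepoll small_values[OF inv], of "\<lambda>y. inv\<^bsub>G\<^esub> y"]
      by (simp add: image_image)
  next
    case (eng x y)
    have "x \<in> carrier F" "y \<in> carrier F"
      using eng F.generate_in_carrier[OF sub] by auto
    then have "(\<lambda>g. \<theta> g (x \<otimes>\<^bsub>F\<^esub> y)) ` A = (\<lambda>g. \<theta> g x \<otimes>\<^bsub>G\<^esub> \<theta> g y) ` A"
      using hom_mult[OF \<theta>] by (intro image_cong) auto
    then show ?case using lesspoll_image2[OF eng.IH, of "\<lambda>a b. a \<otimes>\<^bsub>G\<^esub> b"] by simp
  qed
qed

text \<open>In the free group the left-normed commutator of the generators lies in the verbal subgroup;
  specializing the generators gives every value of the \<open>\<gamma>\<close>-word in \<^term>\<open>G\<close>.\<close>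

lemma gamma_values_small:
  fixes F :: "('f, 'k) monoid_scheme"
  assumes F: "group F" and F_free: "F \<cong> free_group (UNIV :: nat set)"
    and w: "fst ` set w \<subseteq> {1..r}"
    and nil: "lower_central (F Mod verbal_subgroup F r w) n = {\<one>\<^bsub>F Mod verbal_subgroup F r w\<^esub>}"
    and small: "word_values G r w \<prec> (UNIV :: nat set set)"
  shows "gamma_values G n \<prec> (UNIV :: nat set set)"
proof -
  interpret F: group F by (rule F)
  obtain \<phi> where \<phi>: "\<phi> \<in> iso F (free_group (UNIV :: nat set))" using F_free by (auto simp: is_iso_def)
  have "[(k, True)] \<in> \<phi> ` carrier F" for k
    using \<phi> by (auto simp: iso_def bij_betw_def free_group_def)
  then have "\<forall>k. \<exists>a. a \<in> carrier F \<and> \<phi> a = [(k, True)]" by (metis imageE)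
  then obtain a where a: "\<And>k. a k \<in> carrier F" "\<And>k. \<phi> (a k) = [(k, True)]" by metis
  define A where "A = (UNIV :: nat set) \<rightarrow> carrier G"
  define \<theta> where "\<theta> g x = word_eval G g (\<phi> x)" for g x
  have hom: "\<theta> g \<in> hom F G" if "g \<in> A" for g
  proof -
    have "\<phi> \<in> hom F (free_group UNIV)" using \<phi> by (simp add: iso_def)
    moreover have "word_eval G g \<in> hom (free_group UNIV) G"
      using that by (intro word_eval_hom) (simp add: A_def)
    ultimately have "word_eval G g \<circ> \<phi> \<in> hom F G" by (rule Group.hom_compose)
    moreover have "\<theta> g = word_eval G g \<circ> \<phi>" by (simp add: fun_eq_iff \<theta>_def)
    ultimately show ?thesis by simp
  qed
  define x where "x = left_normed F a n"
  have x: "x \<in> verbal_subgroup F r w"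
    unfolding x_def by (rule F.left_normed_verbal[OF w nil a(1)])
  have small': "(\<lambda>g. \<theta> g x) ` A \<prec> (UNIV :: nat set set)"
    by (rule verbal_images_small[OF F hom w small x])
  have "gamma_values G n \<subseteq> (\<lambda>g. \<theta> g x) ` A"
  proof
    fix y assume "y \<in> gamma_values G n"
    then obtain g where g: "g \<in> {..n} \<rightarrow>\<^sub>E carrier G" "y = left_normed G g n"
      unfolding gamma_values_eq by blast
    \<comment> \<open>A homomorphism from \<open>F\<close> needs an image for every generator; those
      beyond \<open>n\<close> do not occur in \<open>x\<close> and are sent to
      \<open>\<one>\<close>.\<close>
    define h where "h k = (if k \<le> n then g k else \<one>)" for k
    have h: "h \<in> A" using g(1) by (auto simp: A_def h_def)
    interpret group_hom F G "\<theta> h"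
      by (intro group_hom.intro group_hom_axioms.intro F is_group hom[OF h])
    have "\<theta> h x = left_normed G (\<lambda>k. \<theta> h (a k)) n"
      unfolding x_def by (rule hom_left_normed[OF a(1)])
    also have "\<dots> = left_normed G g n"
    proof (rule left_normed_cong)
      fix k assume "k \<le> n"
      moreover have "word_eval G h [(k, True)] = h k"
        using h by (intro word_eval_generator) (auto simp: A_def)
      ultimately show "\<theta> h (a k) = g k"
        by (simp add: \<theta>_def a(2) h_def)
    qed
    finally show "y \<in> (\<lambda>g. \<theta> g x) ` A" using g(2) h by (intro image_eqI[of _ _ h]) simp_all
  qed
  then show ?thesis using small' subset_imp_lepoll lesspoll_trans1 by blast
qed

text \<open>The sequence \<open>p\<close> of values at the \<open>s\<close>-th powers starts with
  \<open>\<one>\<close> and \<open>v\<close>, so its first difference at \<open>0\<close> is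
  \<open>v\<close> itself, and \<open>torsion_diff\<close> gives the claim.\<close>

lemma word_values_torsion:
  assumes w: "fst ` set w \<subseteq> {1..r}"
    and fin: "finite (word_values G r w)" and gam: "finite (gamma_values G (Suc n))"
    and v: "v \<in> word_values G r w"
  shows "\<exists>k::nat>0. v [^] k = \<one>"
proof -
  define K where "K = generate G (gamma_values G (Suc n))"
  have finK: "finite K" unfolding K_def by (rule finite_generate_gamma_values[OF gam])
  have K: "K \<lhd> G"
    unfolding K_def
    by (rule normal_generateI[OF gamma_values_closed conj_closedD(2)[OF conj_closed_gamma_values]])
  have "gamma_values G (Suc n) \<subseteq> K" unfolding K_def by (blast intro: generate.incl)
  from gamma_values_rel_upper_central[OF this order_refl]
  have "carrier G \<subseteq> rel_upper_central G K (carrier G) (Suc n)" by (simp del: rel_upper_central.simps)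
  from rel_lower_central_subset_upper[OF K normal_self this order_refl]
  \<comment> \<open>Positive indices of this series count entries, and members of
    \<open>gamma_values G (Suc n)\<close> have \<open>Suc (Suc n)\<close> of them.\<close>
  have "rel_lower_central G (carrier G) (Suc (Suc n)) \<subseteq> K" by (simp del: rel_lower_central.simps)
  then have finH: "finite (rel_lower_central G (carrier G) (0 + Suc (Suc n)))"
    using finK finite_subset by (simp del: rel_lower_central.simps)
  interpret group_filtration G "rel_lower_central G (carrier G)"
    by (rule group_filtration_rel_lower_central[OF normal_self])
  interpret polynomial_sequences G "rel_lower_central G (carrier G)"
    by unfold_locales simp
  obtain g where g: "g \<in> {1..r} \<rightarrow> carrier G" "v = word_eval G g w"
    using v by (auto simp: word_values_def)
  have gc: "g i \<in> carrier G" if "i \<in> fst ` set w" for i using g(1) w that by auto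
  define p where "p s = word_eval G (\<lambda>i. g i [^] s) w" for s :: nat
  have coord: "poly_map m 0 (\<lambda>s. g i [^] s)" if i: "i \<in> fst ` set w" for m i
  proof (cases m)
    case (Suc k)
    have "poly_map k (Suc 0) (diff_map Suc (\<lambda>s. g i [^] s))"
    proof (rule poly_map_cong)
      show "poly_map k (Suc 0) (\<lambda>_. g i)" using gc[OF i] by (intro poly_map_const) simp
      show "g i = diff_map Suc (\<lambda>s. g i [^] s) s" for s
        using gc[OF i] by (simp add: diff_map_def cancel_inv)
    qed
    then show ?thesis using Suc gc[OF i] by simp
  qed (use gc[OF i] in simp)
  have poly: "poly_map m 0 p" for m
    unfolding p_def by (rule poly_map_word_eval[OF coord])
  have ran: "range p \<subseteq> word_values G r w"
  proof (rule image_subsetI)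
    fix s :: nat
    have "(\<lambda>i. g i [^] s) \<in> {1..r} \<rightarrow> carrier G"
      using nat_pow_closed[OF funcset_mem[OF g(1)]] by blast
    then show "p s \<in> word_values G r w" unfolding p_def word_values_def by blast
  qed
  have finp: "finite (range p)" by (rule finite_subset[OF ran fin])
  have "word_values G r w \<subseteq> generate G (word_values G r w)" by (simp add: generate.incl subsetI)
  from torsion_diff[OF fin conj_closed_word_values[OF w] poly finH finp subset_trans[OF ran this], of 0]
  obtain k :: nat where k: "k > 0" "diff_map Suc p 0 [^] k = \<one>" by blast
  have "word_eval G (\<lambda>i. \<one>) u = \<one>" for u :: "nat gword"
    by (induction u) (auto simp: word_eval_def)
  then have "p 0 = \<one>" by (simp add: p_def)
  moreover have "p (Suc 0) = v"
    unfolding p_def g(2) using gc by (intro word_eval_cong) auto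
  moreover have "v \<in> carrier G" using v word_values_subset[OF w] by blast
  ultimately have "diff_map Suc p 0 = v" by (simp add: diff_map_def)
  then show ?thesis using k by auto
qed

end

theorem corollary1p3:
  fixes F :: "('f, 'm) monoid_scheme"
    and G :: "('g, 'n) monoid_scheme"
    and T :: "'g topology"
    and r :: nat
    and w :: "nat gword"
  assumes "group F" and "F \<cong> free_group (UNIV :: nat set)"
    and "w \<in> carrier (free_group {1..r})"
    and "nilpotent_group (F Mod verbal_subgroup F r w)"
    and "profinite_group G T"
    and "word_values G r w \<prec> (UNIV :: nat set set)"
  shows "finite (closed_verbal_subgroup G T r w)"
proof -
  have T: "topological_group G T" "compact_space T" "Hausdorff_space T"
    using assms(5) by (auto simp: profinite_group_def)
  then have "group G" by (simp add: topological_group_def)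
  then interpret group_topology G T
    by (intro group_topology.intro group_topology_axioms.intro T)
  have w: "fst ` set w \<subseteq> {1..r}" using assms(3) by (simp add: free_group_def)
  obtain n where n: "lower_central (F Mod verbal_subgroup F r w) n = {\<one>\<^bsub>F Mod verbal_subgroup F r w\<^esub>}"
    and Q: "group (F Mod verbal_subgroup F r w)"
    using assms(4) by (auto simp: nilpotent_group_def)
  from gamma_values_small[OF assms(1,2) w group.lower_central_Suc_trivial[OF Q n] assms(6)]
  have small: "gamma_values G (Suc n) \<prec> (UNIV :: nat set set)" .
  have "\<exists>N. N \<lhd> G \<and> openin T N \<and> N \<subseteq> rel_upper_central G {\<one>\<^bsub>G\<^esub>} N (Suc n)"
    by (rule nilpotent_open_normal_subgroup[OF T(2,3) small]) blast
  then obtain N where N: "N \<lhd> G" "openin T N" "N \<subseteq> rel_upper_central G {\<one>\<^bsub>G\<^esub>} N (Suc n)"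
    by blast
  \<comment> \<open>\<open>N\<close> lies in term \<open>Suc n\<close> of its upper series, so its
    lower series vanishes one index later. The same \<open>N\<close> and bound serve for both
    \<gamma> and \<open>w\<close>.\<close>
  let ?c = "Suc (Suc n)"
  have "rel_lower_central G N ?c \<subseteq> {\<one>\<^bsub>G\<^esub>}"
    using rel_lower_central_subset_upper[OF one_is_normal N(1,3) order_refl]
    by (simp del: rel_lower_central.simps)
  then have nil: "rel_lower_central G N ?c = {\<one>\<^bsub>G\<^esub>}"
    using subgroup.one_closed[OF normal_imp_subgroup[OF normal_rel_lower_central[OF N(1), of ?c]]]
    by blast
  have ax: "open_normal_nilpotent G T N ?c I" if "finite I" for I :: "nat set"
    by (intro open_normal_nilpotent.intro open_normal_nilpotent_axioms.intro
        group_topology_axioms T N nil that)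
  have gam: "finite (gamma_values G (Suc n))"
  proof -
    interpret I: open_normal_nilpotent G T N ?c "{..Suc n}" by (rule ax) simp
    show ?thesis
      unfolding gamma_values_eq
    proof (rule I.finite_polynomial_values)
      show "continuous_map (product_topology (\<lambda>_. T) {..Suc n}) T (\<lambda>g. left_normed G g (Suc n))"
        by (rule continuous_left_normed) (auto intro: continuous_map_product_projection)
      show "(\<lambda>g. left_normed G g (Suc n)) ` ({..Suc n} \<rightarrow>\<^sub>E carrier G) \<prec> (UNIV :: nat set set)"
        using small unfolding gamma_values_eq .
      fix t assume t: "t \<in> {..Suc n} \<rightarrow> carrier G"
      show "polynomial_maps.poly_map G (rel_lower_central G N) (coset_box {..Suc n} N t) I.shifts ?c 0
          (\<lambda>g. left_normed G g (Suc n))"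
        by (rule polynomial_maps.poly_map_left_normed[OF I.polynomial_maps_box[OF t]],
            rule I.poly_map_coordinate[OF t]) simp
    qed
  qed
  have fin: "finite (word_values G r w)"
  proof -
    interpret I: open_normal_nilpotent G T N ?c "{1..r}" by (rule ax) simp
    show ?thesis
      unfolding word_values_eq[OF w]
    proof (rule I.finite_polynomial_values)
      show "continuous_map (product_topology (\<lambda>_. T) {1..r}) T (\<lambda>g. word_eval G g w)"
        using w by (intro continuous_word_eval continuous_map_product_projection) auto
      show "(\<lambda>g. word_eval G g w) ` ({1..r} \<rightarrow>\<^sub>E carrier G) \<prec> (UNIV :: nat set set)"
        using assms(6) unfolding word_values_eq[OF w] .
      fix t assume t: "t \<in> {1..r} \<rightarrow> carrier G"
      show "polynomial_maps.poly_map G (rel_lower_central G N) (coset_box {1..r} N t) I.shifts ?c 0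
          (\<lambda>g. word_eval G g w)"
        by (rule polynomial_maps.poly_map_word_eval[OF I.polynomial_maps_box[OF t]],
            rule I.poly_map_coordinate[OF t]) (use w in blast)
    qed
  qed
  have finV: "finite (generate G (word_values G r w))"
    using finite_generate_torsion[OF fin conj_closed_word_values[OF w]]
      word_values_torsion[OF w fin gam] by blast
  have sub: "word_values G r w \<subseteq> carrier G" by (rule word_values_subset[OF w])
  \<comment> \<open>Being finite, the abstract verbal subgroup is closed already, so it contains the
    hull.\<close>
  have "closedin T (generate G (word_values G r w))"
    using finV Hausdorff_imp_t1_space[OF T(3)] generate_incl[OF sub]
    by (simp add: t1_space_closedin_finite)
  then have "closed_verbal_subgroup G T r w \<subseteq> generate G (word_values G r w)"
    unfolding closed_verbal_subgroup_def
    by (intro hull_minimal conjI generate_is_subgroup sub) (auto intro: generate.incl)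
  then show ?thesis using finV finite_subset by blast
qed

end
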